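(* If the family $\{f_t\}_t$ is Newton-admissible, then it has a uniform stable radius: there exist $\tau>0$ and $r>0$ such that for every pair $(\varepsilon,\varepsilon')$ with $0<\varepsilon'\le\varepsilon\le r$ there exists $\delta(\varepsilon,\varepsilon')>0$ such that for every $\eta\in\mathbb{C}$ with $0<|\eta|\le\delta(\varepsilon,\varepsilon')$ and every $t$ with $|t|\le\tau$, the hypersurface $V(f_t-\eta)=\{\mathbf z: f_t(\mathbf z)=\eta\}$ is non-singular in the open ball $\mathring{B}_r\subseteq\mathbb{C}^n$ and intersects the sphere $\mathbb{S}_{\varepsilon''}$ transversely for every $\varepsilon''\in[\varepsilon',\varepsilon]$ (balls and spheres centred at the origin of $\mathbb{C}^n$).
   Context: Let $(t,\mathbf{z})=(t,z_1,\ldots,z_n)$ be coordinates on $\mathbb{C}\times\mathbb{C}^n$. For $k\in K_0:=\{1,\ldots,k_0\}$ let $f^k\colon\mathbb{C}\times\mathbb{C}^n\to\mathbb{C}$ be a non-constant polynomial with $f^k(t,\mathbf{0})=0$ for all $t$; put $f:=f^1\cdots f^{k_0}$, $f_t(\mathbf{z}):=f(t,\mathbf{z})$, $f^k_t(\mathbf{z}):=f^k(t,\mathbf{z})$. All statements concern germs at the origin. Newton data: for a polynomial $g(\mathbf{z})=\sum_\alpha c_\alpha\mathbf{z}^\alpha$ with $g(\mathbf{0})=0$, $\Gamma_+(g)$ is the convex hull in $\mathbb{R}^n_+$ of $\bigcup_{c_\alpha\neq0}(\alpha+\mathbb{R}^n_+)$, and the Newton boundary $\Gamma(g)$ is the union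 of its compact faces. For a weight vector $\mathbf{w}=(w_1,\ldots,w_n)\in\mathbb{N}^n\setminus\{\mathbf{0}\}$ (nonnegative integers), $d(\mathbf{w};g):=\min\{\sum_i w_ix_i : x\in\Gamma_+(g)\}$, $\Delta(\mathbf{w};g)$ is the face of $\Gamma_+(g)$ where this minimum is attained, $g_{\mathbf{w}}:=\sum_{\alpha\in\Delta(\mathbf{w};g)}c_\alpha\mathbf{z}^\alpha$ is the face function, and $I(\mathbf{w}):=\{i: w_i=0\}$. $\mathbf w$ is positive if all $w_i>0$. For $I\subseteq\{1,\ldots,n\}$, $\mathbb{C}^I:=\{\mathbf{z}: z_i=0 \text{ for } i\notin I\}$ and $\mathbb{C}^{*I}:=\{\mathbf{z}: z_i=0\iff i\notin I\}$; $\mathbb{C}^{*n}=\mathbb{C}^{*\{1,\ldots,n\}}$. $\mathcal{V}_g$ is the set of $I$ with $g|_{\mathbb{C}^I}\equiv0$. For $i_1,\ldots,i_m$ and $u_{i_j}\in\mathbb{C}^*$, $\mathbb{C}^{*n}(u_{i_1},\ldots,u_{i_m}):=\{\mathbf{z}\in\mathbb{C}^{*n}: z_{i_j}=u_{i_j},\ 1\le j\le m\}$. Non-degenerate complete intersection: polynomials $g^1,\ldots,g^p$ vanishing at $\mathbf 0$ define a non-degenerate complete intersection germ $V(g^1,\ldots,g^p)$ if for every positive weight vector $\mathbf{w}$, the $p$-form $dg^1_{\mathbf{w}}\wedge\cdots\wedge dg^p_{\mathbf{w}}$ is nowhere zero on $V^*(g^1_{\mathbf{w}},\ldots,g^p_{\mathbf{w}}):=\{\mathbf{z}\in\mathbb{C}^{*n}: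 g^1_{\mathbf{w}}(\mathbf{z})=\cdots=g^p_{\mathbf{w}}(\mathbf{z})=0\}$. Local tameness: $R>0$ is a radius of local tameness of $\{g^1,\ldots,g^p\}$ if for every nonempty $I=\{i_1,\ldots,i_m\}\in\mathcal{V}_{g^1}\cap\cdots\cap\mathcal{V}_{g^p}$, every $\mathbf{w}\in\mathbb{N}^n\setminus\{\mathbf 0\}$ with $I(\mathbf{w})=I$ and every $u_{i_1},\ldots,u_{i_m}\in\mathbb{C}^*$ with $\sum_j|u_{i_j}|^2<R$, the set $V^*(g^1_{\mathbf{w}},\ldots,g^p_{\mathbf{w}})\cap\mathbb{C}^{*n}(u_{i_1},\ldots,u_{i_m})$ is a reduced non-singular complete intersection in $\mathbb{C}^{*n}(u_{i_1},\ldots,u_{i_m})$, i.e. the differentials of $g^1_{\mathbf{w}},\ldots,g^p_{\mathbf{w}}$ with respect to the variables $(z_i)_{i\notin I}$ are linearly independent at each of its points; the germ is locally tame if such $R$ exists. Newton-admissible: $\{f_t\}_t$ is Newton-admissible if there is $R>0$ such that for all sufficiently small $t$: (i) for each $k\in K_0$, $\Gamma(f^k_t)$ is independent of $t$; (ii) for every nonempty $\{k_1,\ldots,k_p\}\subseteq K_0$, $V(f^{k_1}_t,\ldots,f^{k_p}_t)$ is a non-degenerate, locally tame complete intersection germ having a radius of local tameness greater than $R$ ($R$ independent of $t$ and of the subset). *)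

theory Defs
  imports "HOL-Analysis.Analysis"
begin

text \<open>Polynomials in z = (z_i)_{i in 'n} are represented by their coefficient
  functions  c :: ('n => nat) => complex  (exponent alpha |-> c_alpha) with finite support.
  Polynomials in (t,z) are represented by  P :: nat => ('n => nat) => complex,
  P j alpha being the coefficient of t^j z^alpha, with finite support.\<close>

type_synonym 'n zpoly = "('n \<Rightarrow> nat) \<Rightarrow> complex"
type_synonym 'n tzpoly = "nat \<Rightarrow> ('n \<Rightarrow> nat) \<Rightarrow> complex"

definition zsupp :: "'n zpoly \<Rightarrow> ('n \<Rightarrow> nat) set" where
  "zsupp c = {\<alpha>. c \<alpha> \<noteq> 0}"

definition is_tzpoly :: "'n tzpoly \<Rightarrow> bool" where
  "is_tzpoly P \<longleftrightarrow> finite {(j, \<alpha>). P j \<alpha> \<noteq> 0}"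

text \<open>Evaluation of a polynomial in z.\<close>
definition zeval :: "('n::finite) zpoly \<Rightarrow> complex ^ 'n \<Rightarrow> complex" where
  "zeval c z = (\<Sum>\<alpha>\<in>zsupp c. c \<alpha> * (\<Prod>i\<in>UNIV. (z $ i) ^ (\<alpha> i)))"

text \<open>Non-constant polynomial in (t,z).\<close>
definition nonconstant_tz :: "'n tzpoly \<Rightarrow> bool" where
  "nonconstant_tz P \<longleftrightarrow> (\<exists>j \<alpha>. (j, \<alpha>) \<noteq> (0, (\<lambda>_. 0)) \<and> P j \<alpha> \<noteq> 0)"

text \<open>Evaluation of a polynomial in (t,z).\<close>
definition tzeval :: "('n::finite) tzpoly \<Rightarrow> complex \<Rightarrow> complex ^ 'n \<Rightarrow> complex" where
  "tzeval P t z = (\<Sum>(j, \<alpha>)\<in>{(j, \<alpha>). P j \<alpha> \<noteq> 0}. P j \<alpha> * t ^ j * (\<Prod>i\<in>UNIV. (z $ i) ^ (\<alpha> i)))"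

text \<open>The polynomial  f_t = P(t, .)  in z, as a coefficient function.\<close>
definition slice :: "'n tzpoly \<Rightarrow> complex \<Rightarrow> 'n zpoly" where
  "slice P t = (\<lambda>\<alpha>. \<Sum>j\<in>{j. P j \<alpha> \<noteq> 0}. P j \<alpha> * t ^ j)"

text \<open>Complex partial derivative and gradient of a function on C^n.\<close>
definition cpartial :: "(complex ^ 'n \<Rightarrow> complex) \<Rightarrow> 'n \<Rightarrow> complex ^ 'n \<Rightarrow> complex" where
  "cpartial h i z = deriv (\<lambda>w. h (\<chi> j. if j = i then w else z $ j)) (z $ i)"

definition cgrad :: "(complex ^ 'n \<Rightarrow> complex) \<Rightarrow> complex ^ 'n \<Rightarrow> complex ^ 'n" where
  "cgrad h z = (\<chi> i. cpartial h i z)"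

text \<open>Newton data.\<close>
definition exp_vec :: "('n::finite \<Rightarrow> nat) \<Rightarrow> real ^ 'n" where
  "exp_vec \<alpha> = (\<chi> i. real (\<alpha> i))"

definition newton_polyhedron :: "('n::finite) zpoly \<Rightarrow> (real ^ 'n) set" where
  "newton_polyhedron c =
     convex hull (\<Union>\<alpha>\<in>zsupp c. {x. \<forall>i. x $ i \<ge> exp_vec \<alpha> $ i})"

definition newton_boundary :: "('n::finite) zpoly \<Rightarrow> (real ^ 'n) set" where
  "newton_boundary c = \<Union>{F. F face_of newton_polyhedron c \<and> compact F}"

definition wlin :: "('n::finite \<Rightarrow> nat) \<Rightarrow> real ^ 'n \<Rightarrow> real" where
  "wlin w x = (\<Sum>i\<in>UNIV. real (w i) * x $ i)"

definition newton_d :: "('n::finite \<Rightarrow> nat) \<Rightarrow> 'n zpoly \<Rightarrow> real" where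
  "newton_d w c = Inf (wlin w ` newton_polyhedron c)"

definition newton_face :: "('n::finite \<Rightarrow> nat) \<Rightarrow> 'n zpoly \<Rightarrow> (real ^ 'n) set" where
  "newton_face w c = {x \<in> newton_polyhedron c. wlin w x = newton_d w c}"

text \<open>Face function  g_w.\<close>
definition face_fun :: "('n::finite \<Rightarrow> nat) \<Rightarrow> 'n zpoly \<Rightarrow> 'n zpoly" where
  "face_fun w c = (\<lambda>\<alpha>. if exp_vec \<alpha> \<in> newton_face w c then c \<alpha> else 0)"

text \<open>Linear independence (over C) of a family of vectors indexed by S,
  using only the coordinates in J.\<close>
definition cindep_on :: "'k set \<Rightarrow> 'n set \<Rightarrow> ('k \<Rightarrow> complex ^ 'n) \<Rightarrow> bool" where
  "cindep_on S J v \<longleftrightarrow>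
     (\<forall>a :: 'k \<Rightarrow> complex. (\<forall>i\<in>J. (\<Sum>k\<in>S. a k * v k $ i) = 0) \<longrightarrow> (\<forall>k\<in>S. a k = 0))"

definition torus :: "(complex ^ 'n) set" where
  "torus = {z. \<forall>i. z $ i \<noteq> 0}"

text \<open>Non-degenerate complete intersection  V(g^k, k in S).\<close>
definition nondeg_ci :: "'k set \<Rightarrow> ('k \<Rightarrow> ('n::finite) zpoly) \<Rightarrow> bool" where
  "nondeg_ci S g \<longleftrightarrow>
     (\<forall>w :: 'n \<Rightarrow> nat. (\<forall>i. w i > 0) \<longrightarrow>
        (\<forall>z\<in>torus. (\<forall>k\<in>S. zeval (face_fun w (g k)) z = 0) \<longrightarrow>
           cindep_on S UNIV (\<lambda>k. cgrad (zeval (face_fun w (g k))) z)))"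

text \<open>I in V_g: g vanishes identically on C^I.\<close>
definition vanishes_on_coord :: "(complex ^ 'n \<Rightarrow> complex) \<Rightarrow> 'n set \<Rightarrow> bool" where
  "vanishes_on_coord h I \<longleftrightarrow> (\<forall>z. (\<forall>i. i \<notin> I \<longrightarrow> z $ i = 0) \<longrightarrow> h z = 0)"

text \<open>R is a radius of local tameness of {g^k, k in S}.  The point z ranges over
  C^{*n}(u_{i_1},...,u_{i_m}) with u_i = z_i (i in I).\<close>
definition tame_radius :: "'k set \<Rightarrow> ('k \<Rightarrow> ('n::finite) zpoly) \<Rightarrow> real \<Rightarrow> bool" where
  "tame_radius S g R \<longleftrightarrow> R > 0 \<and>
     (\<forall>I. I \<noteq> {} \<and> (\<forall>k\<in>S. vanishes_on_coord (zeval (g k)) I) \<longrightarrow>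
       (\<forall>w :: 'n \<Rightarrow> nat. w \<noteq> (\<lambda>_. 0) \<and> {i. w i = 0} = I \<longrightarrow>
         (\<forall>z\<in>torus. (\<Sum>i\<in>I. (cmod (z $ i))\<^sup>2) < R \<and>
                    (\<forall>k\<in>S. zeval (face_fun w (g k)) z = 0) \<longrightarrow>
            cindep_on S (- I) (\<lambda>k. cgrad (zeval (face_fun w (g k))) z))))"

text \<open>Newton-admissibility of the family f_t = prod_{k in {1..k0}} f^k_t.\<close>
definition newton_admissible :: "nat \<Rightarrow> (nat \<Rightarrow> ('n::finite) tzpoly) \<Rightarrow> bool" where
  "newton_admissible k0 F \<longleftrightarrow>
     (\<exists>R>0. \<exists>\<tau>0>0. \<forall>t. cmod t \<le> \<tau>0 \<longrightarrow>
        (\<forall>k\<in>{1..k0}. newton_boundary (slice (F k) t) = newton_boundary (slice (F k) 0)) \<and>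
        (\<forall>S. S \<noteq> {} \<and> S \<subseteq> {1..k0} \<longrightarrow>
           nondeg_ci S (\<lambda>k. slice (F k) t) \<and>
           (\<exists>R'>R. tame_radius S (\<lambda>k. slice (F k) t) R')))"

text \<open>The hypersurface {h = 0} is non-singular at its points in the set A.\<close>
definition nonsingular_in :: "(complex ^ 'n \<Rightarrow> complex) \<Rightarrow> (complex ^ 'n) set \<Rightarrow> bool" where
  "nonsingular_in h A \<longleftrightarrow> (\<forall>z\<in>A. h z = 0 \<longrightarrow> cgrad h z \<noteq> 0)"

text \<open>The hypersurface {h = 0} intersects the sphere S_eps transversely: at every
  intersection point it is smooth and the real tangent spaces
  T_z V = ker dh(z) and T_z S = {b. Re <b,z> = 0} span C^n.\<close>
definition transverse_sphere :: "(complex ^ ('n::finite) \<Rightarrow> complex) \<Rightarrow> real \<Rightarrow> bool" where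
  "transverse_sphere h \<epsilon> \<longleftrightarrow>
     (\<forall>z\<in>sphere 0 \<epsilon>. h z = 0 \<longrightarrow>
        cgrad h z \<noteq> 0 \<and>
        (\<forall>v. \<exists>a b. v = a + b \<and> (\<Sum>i\<in>UNIV. cgrad h z $ i * a $ i) = 0 \<and>
                   Re (\<Sum>i\<in>UNIV. b $ i * cnj (z $ i)) = 0))"

end

theory Submission
  imports Defs "HOL-Analysis.Kronecker_Approximation_Theorem"
begin

text \<open>
  Instead of the curve selection lemma we use sequences.  Given \<open>z\<^sub>j\<close> in a torus, the vectors
  \<open>- ln \<bar>z\<^sub>j\<bar>\<close> split, after passing to a subsequence, into a bounded part and a part orthogonal to
  all differences of exponents whose monomials stay comparable.  Dirichlet's simultaneous approximation
  replaces the latter by an integer weight vector \<open>w\<close> that orders the monomials in the same way, and the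
  bounded part yields a limit point \<open>u\<close> in the torus.  Suitably scaled, \<open>f\<^sup>k\<close> and its logarithmic
  derivatives \<open>z\<^sub>i \<partial>\<^sub>i f\<^sup>k\<close> along the sequence then converge to those of the face function
  \<open>f\<^sup>k\<^sub>w\<close> at \<open>u\<close>.

  Failure of smoothness or transversality is a relation
  \<open>\<Sum>\<^sub>k z\<^sub>i \<partial>\<^sub>i f\<^sup>k / f\<^sup>k = \<mu> \<bar>z\<^sub>i\<bar>\<^sup>2\<close>.  If its coefficients stay bounded in the limit,
  pairing it with \<open>w\<close> and Euler's identity show that no \<open>f\<^sup>k\<close> tends to zero.  Otherwise, normalising
  gives a linear dependence between the gradients of the face functions vanishing at \<open>u\<close>; it is excluded by
  non-degeneracy when \<open>z\<^sub>j\<close> tends to the origin, and by local tameness together with the transversality of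
  small spheres to the strata of the zero fibre when \<open>z\<^sub>j\<close> tends to another point of that fibre.
\<close>

text \<open>Both assumptions on face functions concern weight vectors with natural entries, whereas
  a sequence yields only the real vectors of logarithms of its moduli; hence the detour through
  integer weights. A second obstacle is that the factors tend to zero at unrelated rates. In the
  logarithmic gradient of the product each factor enters as \<open>N\<^sub>k / f\<^sup>k\<close>
  times a scaled derivative, so it can be normalised by its own positive real
  \<open>N\<^sub>k\<close> and no common scale is needed. Multiplication by \<open>z\<^sub>i\<close>
  turns the conjugate of \<open>z\<^sub>i\<close> in the tangency condition into a real square and
  makes the derivatives scale like monomials. Points may lie in coordinate subspaces, so every
  sequence is taken with a fixed pattern of vanishing coordinates; the patterns are finite in
  number, and radii are minimised over them. Smoothness is required in one ball for all small
  nonzero values of eta. It is therefore proved at every point off the zero fibre near the origin.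
  Transversality is required only on a shell around the origin, and it alone costs a delta that
  depends on the shell.\<close>

section \<open>Integer weights and toric limits\<close>

text \<open>Dirichlet's theorem gives a multiple \<open>q\<close> of theta whose coordinates are all
  close to integers \<open>w\<close>. Pairings with the finitely many integral \<open>d\<close> then
  move by less than \<open>\<delta>\<close>: too little to flip a nonzero sign and, since
  \<open>w\<close> pairs with \<open>d\<close> to an integer, too little to leave zero.\<close>

lemma integer_weight:
  fixes \<theta> :: "real ^ 'n::finite" and D :: "(real ^ 'n) set"
  assumes fin: "finite D" and int: "\<And>d i. d \<in> D \<Longrightarrow> d $ i \<in> \<int>"
  obtains w :: "'n \<Rightarrow> int" where
    "\<And>d. d \<in> D \<Longrightarrow> sgn (\<Sum>i\<in>UNIV. of_int (w i) * d $ i) = sgn (\<theta> \<bullet> d)"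
proof -
  define C where "C = 1 + (\<Sum>d\<in>D. \<Sum>i\<in>UNIV. \<bar>d $ i\<bar>)"
  have C0: "C > 0"
    unfolding C_def by (intro add_pos_nonneg sum_nonneg) auto
  have C: "(\<Sum>i\<in>UNIV. \<bar>d $ i\<bar>) \<le> C" if "d \<in> D" for d
  proof -
    have "(\<Sum>i\<in>UNIV. \<bar>d $ i\<bar>) \<le> (\<Sum>d\<in>D. \<Sum>i\<in>UNIV. \<bar>d $ i\<bar>)"
      by (rule member_le_sum[OF that _ fin]) (simp add: sum_nonneg)
    then show ?thesis by (simp add: C_def)
  qed
  \<comment> \<open>The entry 1 serves the zero pairings, where an integer of modulus below 1 must
    vanish. The other entries protect the nonzero pairings, which a factor \<open>q\<close> of at
    least 1 does not shrink.\<close>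
  define \<delta> where "\<delta> = Min (insert 1 ((\<lambda>d. \<bar>\<theta> \<bullet> d\<bar>) ` {d\<in>D. \<theta> \<bullet> d \<noteq> 0}))"
  have \<delta>: "\<delta> > 0" "\<delta> \<le> 1" "\<And>d. d \<in> D \<Longrightarrow> \<theta> \<bullet> d \<noteq> 0 \<Longrightarrow> \<delta> \<le> \<bar>\<theta> \<bullet> d\<bar>"
    unfolding \<delta>_def using fin by (auto intro!: Min_le)
  obtain N0 :: nat where "C / \<delta> < real N0" using reals_Archimedean2 by blast
  then have N: "C / real (Suc N0) < \<delta>" 
    using \<delta> C0 by (simp add: field_simps)
  obtain e :: "'n \<Rightarrow> nat" where e: "bij_betw e UNIV {..<CARD('n)}"
    using ex_bij_betw_finite_nat[of "UNIV::'n set"] by (auto simp: lessThan_atLeast0)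
  obtain q p where q: "0 < q" and p: "\<And>k. k < CARD('n) \<Longrightarrow> 
      \<bar>of_int q * (\<theta> $ (inv_into UNIV e k)) - of_int (p k)\<bar> < 1 / real (Suc N0)"
    by (rule Dirichlet_approx_simult[of "Suc N0" "CARD('n)" "\<lambda>k. \<theta> $ (inv_into UNIV e k)"]) auto
  define w where "w i = p (e i)" for i
  have w: "\<bar>of_int q * (\<theta> $ i) - of_int (w i)\<bar> < 1 / real (Suc N0)" for i
    using p[of "e i"] e unfolding w_def bij_betw_def by auto
  have main: "\<bar>of_int q * (\<theta> \<bullet> d) - (\<Sum>i\<in>UNIV. of_int (w i) * d $ i)\<bar> < \<delta>" if d: "d \<in> D" for d
  proof -
    have "of_int q * (\<theta> \<bullet> d) - (\<Sum>i\<in>UNIV. of_int (w i) * d $ i)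
        = (\<Sum>i\<in>UNIV. (of_int q * \<theta> $ i - of_int (w i)) * d $ i)"
      by (simp add: inner_vec_def sum_distrib_left sum_subtractf left_diff_distrib mult.assoc)
    also have "\<bar>\<dots>\<bar> \<le> (\<Sum>i\<in>UNIV. \<bar>(of_int q * \<theta> $ i - of_int (w i)) * d $ i\<bar>)"
      by (rule sum_abs)
    also have "\<dots> \<le> (\<Sum>i\<in>UNIV. 1 / real (Suc N0) * \<bar>d $ i\<bar>)"
      unfolding abs_mult by (intro sum_mono mult_right_mono less_imp_le[OF w] abs_ge_zero)
    also have "\<dots> \<le> 1 / real (Suc N0) * C"
      unfolding sum_distrib_left[symmetric] by (intro mult_left_mono C d) auto
    also have "\<dots> < \<delta>" using N by simp
    finally show ?thesis .
  qed
  show thesis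
  proof
    fix d assume d: "d \<in> D"
    let ?s = "\<Sum>i\<in>UNIV. of_int (w i) * d $ i"
    have ints: "?s \<in> \<int>" using int[OF d] by (intro Ints_sum Ints_mult) auto
    have m: "\<bar>of_int q * (\<theta> \<bullet> d) - ?s\<bar> < \<delta>" by (rule main[OF d])
    consider "\<theta> \<bullet> d = 0" | "\<theta> \<bullet> d > 0" | "\<theta> \<bullet> d < 0" by linarith
    then show "sgn ?s = sgn (\<theta> \<bullet> d)"
    proof cases
      case 1
      then have "\<bar>?s\<bar> < 1" using m \<delta> by simp
      then have "?s = 0" using ints Ints_nonzero_abs_less1 by blast
      then show ?thesis using 1 by simp
    next
      case 2
      have "\<theta> \<bullet> d \<le> of_int q * (\<theta> \<bullet> d)" using q 2 by simp
      then have "?s > 0" using \<delta>(3)[OF d] 2 m by linarith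
      then show ?thesis using 2 by simp
    next
      case 3
      have "of_int q * (\<theta> \<bullet> d) \<le> \<theta> \<bullet> d" 
        using mult_right_mono_neg[of 1 "of_int q" "\<theta> \<bullet> d"] q 3 by simp
      then have "?s < 0" using \<delta>(3)[OF d] 3 m by linarith
      then show ?thesis using 3 by simp
    qed
  qed
qed

text \<open>\<open>L'\<close> is \<open>L\<close> minus its orthogonal projection to
  \<open>span D\<close>. The vectors along which \<open>L\<close> has bounded pairings form a
  subspace, so the bounds pass from \<open>D\<close> to an orthonormal basis of
  \<open>span D\<close>, and the projection is bounded.\<close>

lemma orthogonal_part_bounded:
  fixes L :: "nat \<Rightarrow> 'a::euclidean_space" and D :: "'a set"
  assumes bdd: "\<And>d. d \<in> D \<Longrightarrow> bounded (range (\<lambda>j. L j \<bullet> d))"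
  obtains L' where "\<And>j d. d \<in> D \<Longrightarrow> L' j \<bullet> d = 0" "bounded (range (\<lambda>j. L j - L' j))"
proof -
  obtain B where B: "B \<subseteq> span D" "pairwise orthogonal B" "\<And>x. x \<in> B \<Longrightarrow> norm x = 1"
      "independent B" "span B = span D"
    using orthonormal_basis_subspace[of "span D"] by (metis subspace_span)
  have finB: "finite B" using B(4) independent_imp_finite by blast
  have sub: "subspace {x. bounded (range (\<lambda>j. L j \<bullet> x))}"
    unfolding subspace_def
  proof (safe)
    fix x y assume "bounded (range (\<lambda>j. L j \<bullet> x))" "bounded (range (\<lambda>j. L j \<bullet> y))"
    then show "bounded (range (\<lambda>j. L j \<bullet> (x + y)))"
      unfolding inner_add_right by (rule bounded_plus_comp)
  next
    fix c x assume "bounded (range (\<lambda>j. L j \<bullet> x))"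
    then have "bounded ((\<lambda>y. c *\<^sub>R y) ` range (\<lambda>j. L j \<bullet> x))" by (rule bounded_scaling)
    then show "bounded (range (\<lambda>j. L j \<bullet> (c *\<^sub>R x)))" by (simp add: image_image)
  qed (auto)
  have bb: "bounded (range (\<lambda>j. L j \<bullet> b))" if "b \<in> B" for b
  proof -
    have "span D \<subseteq> {x. bounded (range (\<lambda>j. L j \<bullet> x))}"
      by (rule span_minimal[OF _ sub]) (use bdd in auto)
    then show ?thesis using that B(1) by auto
  qed
  define L' where "L' j = L j - (\<Sum>b\<in>B. (L j \<bullet> b) *\<^sub>R b)" for j
  have orth: "L' j \<bullet> b = 0" if "b \<in> B" for j b
  proof -
    have "(\<Sum>c\<in>B. (L j \<bullet> c) *\<^sub>R c) \<bullet> b = (\<Sum>c\<in>B. if c = b then L j \<bullet> b else 0)"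
      unfolding inner_sum_left
    proof (intro sum.cong refl)
      fix c assume "c \<in> B"
      then show "(L j \<bullet> c) *\<^sub>R c \<bullet> b = (if c = b then L j \<bullet> b else 0)"
        using B(2,3) that by (auto simp: pairwise_def orthogonal_def norm_eq_1)
    qed
    then show ?thesis using that finB by (simp add: L'_def inner_diff_left)
  qed
  have "orthogonal (L' j) d" if "d \<in> D" for j d
    by (rule orthogonal_to_span[of d B]) (use that B(5) orth in \<open>auto simp: orthogonal_def span_base\<close>)
  then have o: "\<And>j d. d \<in> D \<Longrightarrow> L' j \<bullet> d = 0" by (auto simp: orthogonal_def)
  have "bounded (range (\<lambda>j. \<Sum>b\<in>B. (L j \<bullet> b) *\<^sub>R b))"
    using finB bb
  proof (induction B rule: finite_induct)
    case (insert b B)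
    obtain c where c: "\<And>j. norm (L j \<bullet> b) \<le> c" using insert.prems[of b] by (auto simp: bounded_iff)
    have "bounded (range (\<lambda>j. (L j \<bullet> b) *\<^sub>R b))"
      unfolding bounded_iff using c by (auto intro!: exI[of _ "c * norm b"] mult_right_mono)
    then show ?case using insert by (simp add: bounded_plus_comp)
  qed auto
  then show thesis using o that[of L'] by (simp add: L'_def)
qed

text \<open>Infinite limits are wanted: for a difference of two exponents, a finite limit means that
  the monomials stay comparable, and an infinite one tells which of them dominates.\<close>

lemma common_ereal_limits:
  fixes x :: "'d \<Rightarrow> nat \<Rightarrow> ereal"
  assumes "finite D"
  obtains r l where "strict_mono (r::nat\<Rightarrow>nat)" "\<And>d. d \<in> D \<Longrightarrow> (x d \<circ> r) \<longlonglongrightarrow> l d"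
  using assms
proof (induction D arbitrary: thesis rule: finite_induct)
  case empty
  show ?case by (rule empty(1)[of id]) (auto simp: strict_mono_def)
next
  case (insert d D)
  obtain r l where r: "strict_mono r" "\<And>d. d \<in> D \<Longrightarrow> (x d \<circ> r) \<longlonglongrightarrow> l d"
    using insert.IH by blast
  obtain a s where s: "strict_mono s" "((x d \<circ> r) \<circ> s) \<longlonglongrightarrow> a"
    using compact_complete_linorder by blast
  show ?case
  proof (rule insert.prems[of "r \<circ> s" "l(d := a)"])
    show "strict_mono (r \<circ> s)" using r s strict_mono_o by blast
    show "(x e \<circ> (r \<circ> s)) \<longlonglongrightarrow> (l(d := a)) e" if "e \<in> insert d D" for e
    proof (cases "e = d")
      case True then show ?thesis using s by (simp add: o_assoc)
    next
      case False 
      with that have "(x e \<circ> r) \<longlonglongrightarrow> l e" by (intro r) auto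
      from LIMSEQ_subseq_LIMSEQ[OF this s(1)] False show ?thesis by (simp add: o_assoc)
    qed
  qed
qed

lemma common_bounded_limits:
  fixes x :: "'d \<Rightarrow> nat \<Rightarrow> complex"
  assumes "finite D" "\<And>d. d \<in> D \<Longrightarrow> bounded (range (x d))"
  obtains r l where "strict_mono (r::nat\<Rightarrow>nat)" "\<And>d. d \<in> D \<Longrightarrow> (\<lambda>j. x d (r j)) \<longlonglongrightarrow> l d"
  using assms
proof (induction D arbitrary: thesis rule: finite_induct)
  case empty
  show ?case by (rule empty(1)[of id]) (auto simp: strict_mono_def)
next
  case (insert d D)
  obtain r l where r: "strict_mono r" "\<And>d. d \<in> D \<Longrightarrow> (\<lambda>j. x d (r j)) \<longlonglongrightarrow> l d"
    using insert.IH insert.prems(2) by blast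
  have "bounded (range (\<lambda>j. x d (r j)))"
    using insert.prems(2)[of d] by (rule bounded_subset) auto
  then obtain a s where s: "strict_mono s" "((\<lambda>j. x d (r j)) \<circ> s) \<longlonglongrightarrow> a"
    using bounded_imp_convergent_subsequence by blast
  show ?case
  proof (rule insert.prems(1)[of "r \<circ> s" "l(d := a)"])
    show "strict_mono (r \<circ> s)" using r s strict_mono_o by blast
    show "(\<lambda>j. x e ((r \<circ> s) j)) \<longlonglongrightarrow> (l(d := a)) e" if "e \<in> insert d D" for e
    proof (cases "e = d")
      case True then show ?thesis using s by (simp add: o_def)
    next
      case False 
      with that have "(\<lambda>j. x e (r j)) \<longlonglongrightarrow> l e" by (intro r) auto
      from LIMSEQ_subseq_LIMSEQ[OF this s(1)] False show ?thesis by (simp add: o_def)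
    qed
  qed
qed

section \<open>Limits of monomials along sequences in a torus\<close>

definition zmonom :: "complex ^ 'n::finite \<Rightarrow> ('n \<Rightarrow> nat) \<Rightarrow> complex" where
  "zmonom z \<alpha> = (\<Prod>i\<in>UNIV. (z $ i) ^ \<alpha> i)"

definition wdeg :: "('n::finite \<Rightarrow> nat) \<Rightarrow> ('n \<Rightarrow> nat) \<Rightarrow> nat" where
  "wdeg w \<alpha> = (\<Sum>i\<in>UNIV. w i * \<alpha> i)"

lemma tendsto_zmonom:
  assumes "(z \<longlongrightarrow> z0) F" shows "((\<lambda>j. zmonom (z j) \<alpha>) \<longlongrightarrow> zmonom z0 \<alpha>) F"
  unfolding zmonom_def using assms by (intro tendsto_intros)

lemma zmonom_scale:
  fixes \<theta> :: "real ^ 'n::finite"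
  shows "zmonom (\<chi> i. exp (of_real (\<theta> $ i)) * z $ i) \<alpha> = exp (of_real (\<theta> \<bullet> exp_vec \<alpha>)) * zmonom z \<alpha>"
proof -
  have "(\<Prod>i\<in>UNIV. exp (complex_of_real (\<theta> $ i)) ^ \<alpha> i) = exp (of_real (\<theta> \<bullet> exp_vec \<alpha>))"
    by (simp add: inner_vec_def exp_vec_def exp_sum exp_of_nat_mult[symmetric] mult.commute)
  then show ?thesis
    by (simp add: zmonom_def power_mult_distrib prod.distrib)
qed

lemma zmonom_eq_0_iff: "zmonom z \<alpha> = 0 \<longleftrightarrow> (\<exists>i. \<alpha> i > 0 \<and> z $ i = 0)"
  by (auto simp: zmonom_def)

text \<open>Rescaling \<open>z j\<close> by the exponentials of the coordinates of \<open>L'\<close>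
  gives points \<open>uu j\<close> whose moduli are bounded above and below; \<open>u\<close> is a
  limit of them. Dividing a monomial \<open>\<alpha>\<close> of \<open>z\<close> by
  \<open>M j \<beta>\<close> leaves the monomial \<open>\<alpha>\<close> of \<open>uu\<close> times
  the exponential of minus the pairing of \<open>L'\<close> with the exponent difference. This
  factor is 1 if the weights agree and tends to 0 if \<open>\<alpha>\<close> is heavier.\<close>

lemma toric_limit_torus:
  fixes z :: "nat \<Rightarrow> complex ^ 'n::finite" and E :: "('n \<Rightarrow> nat) set"
  assumes finE: "finite E" and torus: "\<And>j i. z j $ i \<noteq> 0" and lim: "z \<longlonglongrightarrow> z0"
  obtains r w u M where "strict_mono r" "\<And>i. w i = 0 \<longleftrightarrow> z0 $ i \<noteq> 0"
    "\<And>i. u $ i \<noteq> 0" "\<And>i. z0 $ i \<noteq> 0 \<Longrightarrow> u $ i = z0 $ i" "\<And>j \<beta>. M j \<beta> > (0::real)"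
    "\<And>\<alpha> \<beta>. \<alpha> \<in> E \<Longrightarrow> \<beta> \<in> E \<Longrightarrow> wdeg w \<alpha> = wdeg w \<beta> \<Longrightarrow>
       (\<lambda>j. zmonom (z (r j)) \<alpha> / of_real (M j \<beta>)) \<longlonglongrightarrow> zmonom u \<alpha>"
    "\<And>\<alpha> \<beta>. \<alpha> \<in> E \<Longrightarrow> \<beta> \<in> E \<Longrightarrow> wdeg w \<beta> < wdeg w \<alpha> \<Longrightarrow>
       (\<lambda>j. zmonom (z (r j)) \<alpha> / of_real (M j \<beta>)) \<longlonglongrightarrow> 0"
proof -
  \<comment> \<open>The unit vectors record the size of each single coordinate, from which the signs
    and the zeros of the weight are read off.\<close>
  define D where "D = (\<lambda>(\<alpha>, \<beta>). exp_vec \<alpha> - exp_vec \<beta>) ` (E \<times> E) \<union> range (\<lambda>i. axis i (1::real))"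
  have finD: "finite D" unfolding D_def using finE by auto
  have intD: "d $ i \<in> \<int>" if "d \<in> D" for d i
    using that unfolding D_def by (auto simp: exp_vec_def axis_def intro!: Ints_diff)
  define L where "L j = (\<chi> i. - ln (cmod (z j $ i)))" for j
  obtain r1 l where r1: "strict_mono r1" and 
    l: "\<And>d. d \<in> D \<Longrightarrow> (\<lambda>j. ereal (L (r1 j) \<bullet> d)) \<longlonglongrightarrow> l d"
    using common_ereal_limits[OF finD, of "\<lambda>d j. ereal (L j \<bullet> d)"] unfolding o_def by metis
  define D0 where "D0 = {d \<in> D. \<bar>l d\<bar> \<noteq> \<infinity>}"
  have "bounded (range (\<lambda>j. L (r1 j) \<bullet> d))" if d: "d \<in> D0" for d
  proof -
    obtain c where "l d = ereal c" using d by (cases "l d") (auto simp: D0_def)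
    then have "(\<lambda>j. L (r1 j) \<bullet> d) \<longlonglongrightarrow> c" using l[of d] d by (auto simp: D0_def)
    then show ?thesis by (rule convergent_imp_bounded)
  qed
  then obtain L' where L'0: "\<And>j d. d \<in> D0 \<Longrightarrow> L' j \<bullet> d = 0"
    and bd: "bounded (range (\<lambda>j. L (r1 j) - L' j))"
    using orthogonal_part_bounded[of D0 "\<lambda>j. L (r1 j)"] by metis
  have bdd: "bounded (range (\<lambda>j. (L' j - L (r1 j)) \<bullet> d))" for d
  proof -
    obtain c where c: "\<And>j. norm (L (r1 j) - L' j) \<le> c" using bd by (auto simp: bounded_iff)
    have "norm ((L' j - L (r1 j)) \<bullet> d) \<le> c * norm d" for j
      using Cauchy_Schwarz_ineq2[of "L' j - L (r1 j)" d] c[of j] 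
        mult_right_mono[OF c[of j] norm_ge_zero[of d]]
      by (simp add: norm_minus_commute)
    then show ?thesis by (auto simp: bounded_iff)
  qed
  have Ltop: "filterlim (\<lambda>j. L' j \<bullet> d) at_top sequentially" if d: "d \<in> D" "l d = \<infinity>" for d
  proof -
    have "filterlim (\<lambda>j. L (r1 j) \<bullet> d) at_top sequentially"
      using l[OF d(1)] d(2) by (simp add: tendsto_PInfty_eq_at_top)
    then have "filterlim (\<lambda>j. (L' j - L (r1 j)) \<bullet> d + L (r1 j) \<bullet> d) at_top sequentially"
      using bdd[of d] 
    proof -
      obtain c where "\<And>j. norm ((L' j - L (r1 j)) \<bullet> d) \<le> c" using bdd[of d] by (auto simp: bounded_iff)
      then have c: "\<And>j. - c \<le> (L' j - L (r1 j)) \<bullet> d" by (metis abs_le_D2 minus_le_iff real_norm_def)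
      have "filterlim (\<lambda>j. - c + L (r1 j) \<bullet> d) at_top sequentially"
        by (rule filterlim_tendsto_add_at_top[OF tendsto_const]) fact
      then show ?thesis by (rule filterlim_at_top_mono) (simp add: c)
    qed
    then show ?thesis by (simp add: inner_diff_left)
  qed
  have Lbot: "filterlim (\<lambda>j. L' j \<bullet> d) at_bot sequentially" if d: "d \<in> D" "l d = -\<infinity>" for d
  proof -
    have "(\<lambda>j. - ereal (L (r1 j) \<bullet> d)) \<longlonglongrightarrow> - l d"
      by (intro tendsto_uminus_ereal l d)
    then have top: "filterlim (\<lambda>j. - (L (r1 j) \<bullet> d)) at_top sequentially"
      using d(2) by (simp add: tendsto_PInfty_eq_at_top)
    obtain c where "\<And>j. norm ((L' j - L (r1 j)) \<bullet> d) \<le> c" using bdd[of d] by (auto simp: bounded_iff)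
    then have c: "\<And>j. - c \<le> - ((L' j - L (r1 j)) \<bullet> d)" by (metis abs_le_D1 neg_le_iff_le real_norm_def)
    have "filterlim (\<lambda>j. - c + - (L (r1 j) \<bullet> d)) at_top sequentially"
      by (rule filterlim_tendsto_add_at_top[OF tendsto_const]) fact
    then have "filterlim (\<lambda>j. - (L' j \<bullet> d)) at_top sequentially"
    proof (rule filterlim_at_top_mono, intro always_eventually allI)
      show "- c + - (L (r1 j) \<bullet> d) \<le> - (L' j \<bullet> d)" for j
        using c[of j] unfolding inner_diff_left by linarith
    qed
    then show ?thesis by (simp add: filterlim_uminus_at_bot)
  qed
  have "eventually (\<lambda>j. \<forall>d\<in>D. (l d = \<infinity> \<longrightarrow> L' j \<bullet> d > 0) \<and> (l d = -\<infinity> \<longrightarrow> L' j \<bullet> d < 0)) sequentially"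
  proof (intro eventually_ball_finite finD ballI eventually_conj)
    fix d assume d: "d \<in> D"
    show "eventually (\<lambda>j. l d = \<infinity> \<longrightarrow> L' j \<bullet> d > 0) sequentially"
      using Ltop[OF d] by (cases "l d = \<infinity>") (auto simp: filterlim_at_top_dense)
    show "eventually (\<lambda>j. l d = -\<infinity> \<longrightarrow> L' j \<bullet> d < 0) sequentially"
      using Lbot[OF d] by (cases "l d = -\<infinity>") (auto simp: filterlim_at_bot_dense)
  qed
  \<comment> \<open>One late index suffices: \<open>L' j0\<close> vanishes on \<open>D0\<close> and
    elsewhere on \<open>D\<close> has the sign of the infinite limit, so an integer vector with the
    same signs orders the monomials as the limits do.\<close>
  then obtain j0 where j0: "\<And>d. d\<in>D \<Longrightarrow> l d = \<infinity> \<Longrightarrow> L' j0 \<bullet> d > 0"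
     "\<And>d. d\<in>D \<Longrightarrow> l d = -\<infinity> \<Longrightarrow> L' j0 \<bullet> d < 0" by (auto simp: eventually_sequentially)
  obtain v :: "'n \<Rightarrow> int" where v: "\<And>d. d \<in> D \<Longrightarrow> sgn (\<Sum>i\<in>UNIV. of_int (v i) * d $ i) = sgn (L' j0 \<bullet> d)"
    using integer_weight[OF finD intD] by metis
  have vsgn: "(\<Sum>i\<in>UNIV. of_int (v i) * d $ i) = 0 \<longleftrightarrow> \<bar>l d\<bar> \<noteq> \<infinity>" 
     "(\<Sum>i\<in>UNIV. of_int (v i) * d $ i) > 0 \<longleftrightarrow> l d = \<infinity>" if d: "d \<in> D" for d
    using v[OF d] j0[OF d] L'0[of d j0] d unfolding D0_def
    by (cases "l d"; auto simp: sgn_if split: if_splits)+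
  have axD: "axis i 1 \<in> D" for i unfolding D_def by auto
  have vax: "(\<Sum>k\<in>UNIV. of_int (v k) * (axis i 1 :: real ^ 'n) $ k) = of_int (v i)" for i
    by (simp add: axis_def if_distrib cong: if_cong)
  have Lax: "L j \<bullet> axis i 1 = - ln (cmod (z j $ i))" for j i
    by (simp add: L_def inner_axis)
  have zi: "(\<lambda>j. cmod (z (r1 j) $ i)) \<longlonglongrightarrow> cmod (z0 $ i)" for i
    using LIMSEQ_subseq_LIMSEQ[OF lim r1] unfolding o_def by (intro tendsto_intros)
  \<comment> \<open>Minus the logarithm of a modulus tends to infinity exactly when the coordinate
    tends to 0. Hence \<open>v\<close> has no negative entry and is zero exactly on the support of
    \<open>z0\<close>.\<close>
  have lax: "if z0 $ i = 0 then l (axis i 1) = \<infinity> else \<bar>l (axis i 1)\<bar> \<noteq> \<infinity>" for i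
  proof (cases "z0 $ i = 0")
    case False
    have "(\<lambda>j. L (r1 j) \<bullet> axis i 1) \<longlonglongrightarrow> - ln (cmod (z0 $ i))"
      unfolding Lax using False by (intro tendsto_intros zi) auto
    then have "(\<lambda>j. ereal (L (r1 j) \<bullet> axis i 1)) \<longlonglongrightarrow> ereal (- ln (cmod (z0 $ i)))"
      by simp
    then have "l (axis i 1) = ereal (- ln (cmod (z0 $ i)))" using l[OF axD] LIMSEQ_unique by blast
    then show ?thesis using False by simp
  next
    case True
    have "filterlim (\<lambda>j. cmod (z (r1 j) $ i)) (at_right 0) sequentially"
      using zi[of i] True torus by (intro filterlim_at_withinI) auto
    then have "filterlim (\<lambda>j. ln (cmod (z (r1 j) $ i))) at_bot sequentially"
      by (rule filterlim_compose[OF ln_at_0])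
    then have "filterlim (\<lambda>j. L (r1 j) \<bullet> axis i 1) at_top sequentially"
      by (simp add: Lax filterlim_uminus_at_bot)
    then have "(\<lambda>j. ereal (L (r1 j) \<bullet> axis i 1)) \<longlonglongrightarrow> \<infinity>"
      by (simp add: tendsto_PInfty_eq_at_top)
    then have "l (axis i 1) = \<infinity>" using l[OF axD] LIMSEQ_unique by blast
    then show ?thesis using True by simp
  qed
  have v0: "v i \<ge> 0" "v i = 0 \<longleftrightarrow> z0 $ i \<noteq> 0" for i
    using vsgn[OF axD[of i]] lax[of i] unfolding vax by (auto split: if_splits)
  define w where "w i = nat (v i)" for i
  have wv: "int (w i) = v i" for i using v0 by (simp add: w_def)
  define uu where "uu j = (\<chi> i. exp (of_real (L' j $ i)) * z (r1 j) $ i)" for j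
  obtain c where c: "\<And>j. norm (L (r1 j) - L' j) \<le> c" using bd by (auto simp: bounded_iff)
  have uu: "cmod (uu j $ i) = exp ((L' j - L (r1 j)) $ i)" for j i
    using torus[of "r1 j" i] by (simp add: uu_def norm_mult L_def exp_add)
  have cc: "\<bar>(L' j - L (r1 j)) $ i\<bar> \<le> c" for i j
    using component_le_norm_cart[of "L (r1 j) - L' j" i] c[of j] by (simp add: abs_minus_commute)
  have uub: "exp (- c) \<le> cmod (uu j $ i)" "cmod (uu j $ i) \<le> exp c" for j i
    unfolding uu using cc[of j i] by auto
  have "bounded (range uu)"
  proof -
    have "norm (uu j) \<le> (\<Sum>i\<in>(UNIV::'n set). exp c)" for j
      unfolding norm_vec_def by (intro order_trans[OF L2_set_le_sum] sum_mono uub norm_ge_zero)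
    then show ?thesis by (auto simp: bounded_iff)
  qed
  then obtain u r2 where r2: "strict_mono r2" and u: "(\<lambda>j. uu (r2 j)) \<longlonglongrightarrow> u"
    using bounded_imp_convergent_subsequence[of uu] by (auto simp: o_def)
  have ui: "(\<lambda>j. uu (r2 j) $ i) \<longlonglongrightarrow> u $ i" for i using u by (intro tendsto_intros)
  have un: "u $ i \<noteq> 0" for i
  proof -
    have "exp (- c) \<le> cmod (u $ i)"
      by (rule LIMSEQ_le_const[OF tendsto_norm[OF ui]]) (use uub in auto)
    then show ?thesis using exp_gt_zero[of "- c"] by (metis norm_zero not_le)
  qed
  have uI: "u $ i = z0 $ i" if i: "z0 $ i \<noteq> 0" for i
  proof -
    \<comment> \<open>With this unit vector in \<open>D0\<close>, the coordinate \<open>i\<close> of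
      \<open>L'\<close> is zero, so \<open>uu\<close> does not rescale that coordinate.\<close>
    have "axis i 1 \<in> D0" using axD[of i] lax[of i] i by (simp add: D0_def)
    then have "L' j $ i = 0" for j using L'0[of "axis i 1" j] by (simp add: inner_axis)
    then have "uu (r2 j) $ i = z (r1 (r2 j)) $ i" for j by (simp add: uu_def)
    moreover have "(\<lambda>j. z (r1 (r2 j)) $ i) \<longlonglongrightarrow> z0 $ i" 
      using LIMSEQ_subseq_LIMSEQ[OF LIMSEQ_subseq_LIMSEQ[OF lim r1] r2] unfolding o_def
      by (intro tendsto_intros)
    ultimately show ?thesis using ui[of i] LIMSEQ_unique by auto
  qed
  define M where "M j \<beta> = exp (- (L' (r2 j) \<bullet> exp_vec \<beta>))" for j and \<beta> :: "'n \<Rightarrow> nat"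
  have ratio: "zmonom (z (r1 (r2 j))) \<alpha> / of_real (M j \<beta>) 
      = of_real (exp (- (L' (r2 j) \<bullet> (exp_vec \<alpha> - exp_vec \<beta>)))) * zmonom (uu (r2 j)) \<alpha>" for j \<alpha> \<beta>
    unfolding uu_def zmonom_scale M_def
    by (simp add: inner_diff_right exp_diff exp_minus field_simps flip: exp_of_real)
  have dD: "exp_vec \<alpha> - exp_vec \<beta> \<in> D" if "\<alpha> \<in> E" "\<beta> \<in> E" for \<alpha> \<beta>
    using that unfolding D_def by auto
  have vd: "(\<Sum>i\<in>UNIV. of_int (v i) * (exp_vec \<alpha> - exp_vec \<beta>) $ i) = real (wdeg w \<alpha>) - real (wdeg w \<beta>)" for \<alpha> \<beta>
    unfolding wv[symmetric] by (simp add: exp_vec_def wdeg_def right_diff_distrib sum_subtractf)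
  show thesis
  proof
    show "strict_mono (r1 \<circ> r2)" using r1 r2 strict_mono_o by blast
    show "w i = 0 \<longleftrightarrow> z0 $ i \<noteq> 0" for i using v0[of i] by (auto simp: w_def)
    show "u $ i \<noteq> 0" for i by (rule un)
    show "z0 $ i \<noteq> 0 \<Longrightarrow> u $ i = z0 $ i" for i by (rule uI)
    show "M j \<beta> > 0" for j \<beta> by (simp add: M_def)
  next
    fix \<alpha> \<beta> assume ab: "\<alpha> \<in> E" "\<beta> \<in> E" "wdeg w \<alpha> = wdeg w \<beta>"
    have "exp_vec \<alpha> - exp_vec \<beta> \<in> D0" 
      using vsgn(1)[OF dD[OF ab(1,2)]] dD[OF ab(1,2)] ab(3) unfolding vd D0_def by simp
    then show "(\<lambda>j. zmonom (z ((r1 \<circ> r2) j)) \<alpha> / of_real (M j \<beta>)) \<longlonglongrightarrow> zmonom u \<alpha>"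
      unfolding o_def ratio by (simp add: L'0 tendsto_zmonom[OF u])
  next
    fix \<alpha> \<beta> assume ab: "\<alpha> \<in> E" "\<beta> \<in> E" "wdeg w \<beta> < wdeg w \<alpha>"
    let ?d = "exp_vec \<alpha> - exp_vec \<beta>"
    have "l ?d = \<infinity>" 
      using vsgn(2)[OF dD[OF ab(1,2)]] ab(3) unfolding vd by simp
    then have "filterlim (\<lambda>j. L' (r2 j) \<bullet> ?d) at_top sequentially"
      using filterlim_compose[OF Ltop[OF dD[OF ab(1,2)]] filterlim_subseq[OF r2]] by simp
    then have "(\<lambda>j. exp (- (L' (r2 j) \<bullet> ?d))) \<longlonglongrightarrow> 0"
      by (intro filterlim_compose[OF exp_at_bot]) (simp add: filterlim_uminus_at_top)
    then have "(\<lambda>j. of_real (exp (- (L' (r2 j) \<bullet> ?d))) * zmonom (uu (r2 j)) \<alpha>) 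
       \<longlonglongrightarrow> of_real 0 * zmonom u \<alpha>"
      by (intro tendsto_intros tendsto_zmonom u)
    then show "(\<lambda>j. zmonom (z ((r1 \<circ> r2) j)) \<alpha> / of_real (M j \<beta>)) \<longlonglongrightarrow> 0"
      unfolding o_def ratio by simp
  qed
qed

text \<open>The torus case is extended to the open torus of \<open>\<complex>\<^sup>J\<close>. The
  additional comparison of weights later forces the minimal exponent of a factor that does not
  vanish on this subspace to involve only coordinates in \<open>J\<close>.\<close>

lemma toric_limit:
  fixes z :: "nat \<Rightarrow> complex ^ 'n::finite" and E :: "('n \<Rightarrow> nat) set"
  assumes finE: "finite E" and J: "\<And>j i. z j $ i \<noteq> 0 \<longleftrightarrow> i \<in> J" and lim: "z \<longlonglongrightarrow> z0"
  obtains r w u M where "strict_mono r" "\<And>i. w i = 0 \<longleftrightarrow> z0 $ i \<noteq> 0"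
    "\<And>i. u $ i \<noteq> 0" "\<And>i. z0 $ i \<noteq> 0 \<Longrightarrow> u $ i = z0 $ i" "\<And>j \<beta>. M j \<beta> > (0::real)"
    "\<And>\<alpha> \<beta>. \<alpha> \<in> E \<Longrightarrow> \<beta> \<in> E \<Longrightarrow> \<exists>i. i \<notin> J \<and> \<alpha> i > 0 \<Longrightarrow> \<forall>i. i \<notin> J \<longrightarrow> \<beta> i = 0 \<Longrightarrow>
       wdeg w \<beta> < wdeg w \<alpha>"
    "\<And>\<alpha> \<beta>. \<alpha> \<in> E \<Longrightarrow> \<beta> \<in> E \<Longrightarrow> \<forall>i. i \<notin> J \<longrightarrow> \<beta> i = 0 \<Longrightarrow> wdeg w \<alpha> = wdeg w \<beta> \<Longrightarrow>
       (\<lambda>j. zmonom (z (r j)) \<alpha> / of_real (M j \<beta>)) \<longlonglongrightarrow> zmonom u \<alpha>"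
    "\<And>\<alpha> \<beta>. \<alpha> \<in> E \<Longrightarrow> \<beta> \<in> E \<Longrightarrow> \<forall>i. i \<notin> J \<longrightarrow> \<beta> i = 0 \<Longrightarrow> wdeg w \<beta> < wdeg w \<alpha> \<Longrightarrow>
       (\<lambda>j. zmonom (z (r j)) \<alpha> / of_real (M j \<beta>)) \<longlonglongrightarrow> 0"
proof -
  \<comment> \<open>Vanishing coordinates are replaced by ones decaying faster than any monomial in the others.\<close>
  define p where "p j = (\<Prod>i\<in>J. min 1 (cmod (z j $ i)))" for j
  define e where "e j = p j ^ j / real (Suc j)" for j
  define z' where "z' j = (\<chi> i. if i \<in> J then z j $ i else of_real (e j))" for j
  have p: "0 < p j" "p j \<le> 1" for j
    unfolding p_def using J by (auto intro!: prod_pos prod_le_1)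
  have pi: "p j \<le> cmod (z j $ i)" if "i \<in> J" for i j
  proof -
    have "p j = min 1 (cmod (z j $ i)) * (\<Prod>i\<in>J-{i}. min 1 (cmod (z j $ i)))"
      unfolding p_def using that by (subst prod.remove[of J i]) auto
    also have "\<dots> \<le> min 1 (cmod (z j $ i)) * 1"
      by (intro mult_left_mono prod_le_1) auto
    finally show ?thesis by simp
  qed
  have e: "0 < e j" "e j \<le> 1 / real (Suc j)" for j
    unfolding e_def using p[of j] by (auto intro!: divide_right_mono power_le_one)
  have elim: "e \<longlonglongrightarrow> 0"
  proof (rule tendsto_sandwich)
    show "eventually (\<lambda>j. 0 \<le> e j) sequentially" using e(1) by (simp add: less_imp_le)
    show "eventually (\<lambda>j. e j \<le> inverse (real (Suc j))) sequentially" using e(2) by (simp add: inverse_eq_divide)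
  qed (use LIMSEQ_inverse_real_of_nat in simp_all)
  have torus: "z' j $ i \<noteq> 0" for i j using J[of j i] e(1)[of j] by (simp add: z'_def)
  have z0J: "z0 $ i = 0" if "i \<notin> J" for i
  proof -
    have "(\<lambda>j. z j $ i) \<longlonglongrightarrow> z0 $ i" using lim by (intro tendsto_intros)
    moreover have "z j $ i = 0" for j using that J by blast
    ultimately show ?thesis by (simp add: LIMSEQ_const_iff)
  qed
  have lim': "z' \<longlonglongrightarrow> z0"
  proof (rule vec_tendstoI)
    fix i show "(\<lambda>j. z' j $ i) \<longlonglongrightarrow> z0 $ i"
    proof (cases "i \<in> J")
      case True
      then show ?thesis using lim by (simp add: z'_def tendsto_vec_nth)
    next
      case False
      have "(\<lambda>j. complex_of_real (e j)) \<longlonglongrightarrow> of_real 0" using elim by (intro tendsto_intros)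
      then show ?thesis using False by (simp add: z'_def z0J)
    qed
  qed
  obtain B0 where B0: "\<And>j. norm (z' j) \<le> B0"
    using convergent_imp_bounded[OF lim'] by (auto simp: bounded_iff)
  define B where "B = max 1 B0"
  have B: "1 \<le> B" "cmod (z' j $ i) \<le> B" for i j
    using B0[of j] Finite_Cartesian_Product.norm_nth_le[of "z' j" i] unfolding B_def by auto
  \<comment> \<open>If \<open>b\<close> is the total degree of \<open>\<beta>\<close>, then
    \<open>p j ^ b\<close> bounds the monomial \<open>\<beta>\<close> from below. The factor
    \<open>p j ^ j\<close> in \<open>e j\<close> cancels this as soon as \<open>j\<close> reaches
    \<open>b\<close>, and the factor \<open>1 / real (Suc j)\<close> provides the decay.\<close>
  have small: "(\<lambda>j. zmonom (z' j) \<alpha> / zmonom (z' j) \<beta>) \<longlonglongrightarrow> 0"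
    if a: "i0 \<notin> J" "\<alpha> i0 > 0" and b: "\<forall>i. i \<notin> J \<longrightarrow> \<beta> i = 0" for \<alpha> \<beta> :: "'n \<Rightarrow> nat" and i0
  proof (rule Lim_null_comparison)
    define b where "b = (\<Sum>i\<in>UNIV. \<beta> i)"
    define a where "a = (\<Sum>i\<in>UNIV. \<alpha> i)"
    have lower: "p j ^ b \<le> cmod (zmonom (z' j) \<beta>)" for j
    proof -
      have "p j ^ b = (\<Prod>i\<in>UNIV. p j ^ \<beta> i)" by (simp add: b_def power_sum)
      also have "\<dots> \<le> (\<Prod>i\<in>UNIV. cmod (z' j $ i) ^ \<beta> i)"
      proof (intro prod_mono conjI)
        fix i show "0 \<le> p j ^ \<beta> i" using p(1)[of j] by simp
        show "p j ^ \<beta> i \<le> cmod (z' j $ i) ^ \<beta> i"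
        proof (cases "i \<in> J")
          case True then show ?thesis using pi[OF True, of j] p(1)[of j] 
            by (auto simp: z'_def intro!: power_mono)
        qed (use b in auto)
      qed
      finally show ?thesis by (simp add: zmonom_def prod_norm[symmetric] norm_power)
    qed
    have upper: "cmod (zmonom (z' j) \<alpha>) \<le> e j * B ^ a" for j
    proof -
      have "cmod (zmonom (z' j) \<alpha>) = cmod (z' j $ i0) ^ \<alpha> i0 * (\<Prod>i\<in>UNIV-{i0}. cmod (z' j $ i) ^ \<alpha> i)"
        unfolding zmonom_def prod_norm[symmetric] norm_power by (rule prod.remove) auto
      also have "\<dots> \<le> e j * (\<Prod>i\<in>UNIV-{i0}. B ^ \<alpha> i)"
      proof (rule mult_mono)
        have "cmod (z' j $ i0) = e j" using a e(1)[of j] by (simp add: z'_def)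
        moreover have "e j \<le> 1" using e(2)[of j] by (rule order_trans) simp
        ultimately show "cmod (z' j $ i0) ^ \<alpha> i0 \<le> e j"
          using power_decreasing[of 1 "\<alpha> i0" "e j"] a e(1)[of j] by simp
      qed (use B e(1)[of j] in \<open>auto intro!: prod_mono prod_nonneg power_mono\<close>)
      also have "\<dots> \<le> e j * (B ^ \<alpha> i0 * (\<Prod>i\<in>UNIV-{i0}. B ^ \<alpha> i))"
        using B(1) e(1)[of j] mult_right_mono[OF one_le_power[OF B(1), of "\<alpha> i0"], of "\<Prod>i\<in>UNIV-{i0}. B ^ \<alpha> i"]
        by (intro mult_left_mono) (simp_all add: prod_nonneg)
      also have "B ^ \<alpha> i0 * (\<Prod>i\<in>UNIV-{i0}. B ^ \<alpha> i) = B ^ a"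
        unfolding a_def power_sum by (rule prod.remove[symmetric]) auto
      finally show ?thesis .
    qed
    have "norm (zmonom (z' j) \<alpha> / zmonom (z' j) \<beta>) \<le> inverse (real (Suc j)) * B ^ a" if "j \<ge> b" for j
    proof -
      have "norm (zmonom (z' j) \<alpha> / zmonom (z' j) \<beta>) \<le> (e j * B ^ a) / p j ^ b"
        unfolding norm_divide using p(1)[of j] lower upper B(1) e(1)[of j]
        by (intro frac_le) auto
      also have "\<dots> = p j ^ (j - b) * inverse (real (Suc j)) * B ^ a"
        using that p(1)[of j] by (simp add: e_def power_diff field_simps)
      also have "\<dots> \<le> 1 * inverse (real (Suc j)) * B ^ a"
        using p[of j] B(1) by (intro mult_right_mono power_le_one) auto
      finally show ?thesis by simp
    qed
    then show "eventually (\<lambda>j. norm (zmonom (z' j) \<alpha> / zmonom (z' j) \<beta>) \<le> inverse (real (Suc j)) * B ^ a) sequentially"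
      by (auto simp: eventually_sequentially)
    show "(\<lambda>j. inverse (real (Suc j)) * B ^ a) \<longlonglongrightarrow> 0"
      by (rule tendsto_mult_left_zero[OF LIMSEQ_inverse_real_of_nat])
  qed
  obtain r w u M where r: "strict_mono r" and w: "\<And>i. w i = 0 \<longleftrightarrow> z0 $ i \<noteq> 0" and
    u: "\<And>i. u $ i \<noteq> 0" "\<And>i. z0 $ i \<noteq> 0 \<Longrightarrow> u $ i = z0 $ i" and M: "\<And>j \<beta>. M j \<beta> > (0::real)" and
    eq: "\<And>\<alpha> \<beta>. \<alpha> \<in> E \<Longrightarrow> \<beta> \<in> E \<Longrightarrow> wdeg w \<alpha> = wdeg w \<beta> \<Longrightarrow>
       (\<lambda>j. zmonom (z' (r j)) \<alpha> / of_real (M j \<beta>)) \<longlonglongrightarrow> zmonom u \<alpha>" and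
    gr: "\<And>\<alpha> \<beta>. \<alpha> \<in> E \<Longrightarrow> \<beta> \<in> E \<Longrightarrow> wdeg w \<beta> < wdeg w \<alpha> \<Longrightarrow>
       (\<lambda>j. zmonom (z' (r j)) \<alpha> / of_real (M j \<beta>)) \<longlonglongrightarrow> 0"
    by (rule toric_limit_torus[OF finE torus lim']) (rule that)
  have un: "zmonom u \<alpha> \<noteq> 0" for \<alpha> using u(1) by (simp add: zmonom_eq_0_iff)
  have zn: "zmonom (z' j) \<alpha> \<noteq> 0" for \<alpha> j using torus by (simp add: zmonom_eq_0_iff)
  \<comment> \<open>Equal weights would give the ratio of the two monomials a nonzero limit, and a
    lighter \<open>\<alpha>\<close> would send the inverse ratio to 0. Both contradict
    \<open>small\<close>.\<close>
  have less: "wdeg w \<beta> < wdeg w \<alpha>" 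
    if E: "\<alpha> \<in> E" "\<beta> \<in> E" and a: "\<exists>i. i \<notin> J \<and> \<alpha> i > 0" and b: "\<forall>i. i \<notin> J \<longrightarrow> \<beta> i = 0" for \<alpha> \<beta>
  proof (rule ccontr)
    assume nl: "\<not> wdeg w \<beta> < wdeg w \<alpha>"
    obtain i0 where i0: "i0 \<notin> J" "\<alpha> i0 > 0" using a by blast
    have s: "(\<lambda>j. zmonom (z' (r j)) \<alpha> / zmonom (z' (r j)) \<beta>) \<longlonglongrightarrow> 0"
      using LIMSEQ_subseq_LIMSEQ[OF small[where \<alpha>=\<alpha> and \<beta>=\<beta>, OF i0 b] r] by (simp add: o_def)
    have Mn: "complex_of_real (M j \<gamma>) \<noteq> 0" for j \<gamma> using M[of j \<gamma>] by simp
    show False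
    proof (cases "wdeg w \<alpha> = wdeg w \<beta>")
      case True
      have "(\<lambda>j. (zmonom (z' (r j)) \<alpha> / of_real (M j \<beta>)) / (zmonom (z' (r j)) \<beta> / of_real (M j \<beta>)))
          \<longlonglongrightarrow> zmonom u \<alpha> / zmonom u \<beta>"
        by (intro tendsto_divide eq E True refl un)
      then have "(\<lambda>j. zmonom (z' (r j)) \<alpha> / zmonom (z' (r j)) \<beta>) \<longlonglongrightarrow> zmonom u \<alpha> / zmonom u \<beta>"
        using Mn by simp
      then show False using s LIMSEQ_unique un by fastforce
    next
      case False
      then have lt: "wdeg w \<alpha> < wdeg w \<beta>" using nl by simp
      have "(\<lambda>j. (zmonom (z' (r j)) \<beta> / of_real (M j \<alpha>)) / (zmonom (z' (r j)) \<alpha> / of_real (M j \<alpha>)))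
          \<longlonglongrightarrow> 0 / zmonom u \<alpha>"
        by (intro tendsto_divide eq gr lt E refl un)
      then have "(\<lambda>j. zmonom (z' (r j)) \<beta> / zmonom (z' (r j)) \<alpha>) \<longlonglongrightarrow> 0"
        using Mn by simp
      from tendsto_mult[OF this s] show False using zn LIMSEQ_unique by (auto simp: LIMSEQ_const_iff)
    qed
  qed
  have mono: "zmonom (z j) \<alpha> = (if \<exists>i. i \<notin> J \<and> \<alpha> i > 0 then 0 else zmonom (z' j) \<alpha>)" for j \<alpha>
  proof (cases "\<exists>i. i \<notin> J \<and> \<alpha> i > 0")
    case True
    then show ?thesis using J by (auto simp: zmonom_eq_0_iff)
  next
    case False
    then have "zmonom (z j) \<alpha> = zmonom (z' j) \<alpha>"
      unfolding zmonom_def z'_def by (intro prod.cong) auto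
    then show ?thesis using False by metis
  qed
  show thesis
  proof (rule that[OF r w u M less])
    fix \<alpha> \<beta> assume E: "\<alpha> \<in> E" "\<beta> \<in> E" and b: "\<forall>i. i \<notin> J \<longrightarrow> \<beta> i = 0"
    { assume "wdeg w \<alpha> = wdeg w \<beta>"
      then have "\<not> (\<exists>i. i \<notin> J \<and> \<alpha> i > 0)" "(\<lambda>j. zmonom (z' (r j)) \<alpha> / of_real (M j \<beta>)) \<longlonglongrightarrow> zmonom u \<alpha>"
        using less[OF E _ b] eq[OF E] by auto
      then show "(\<lambda>j. zmonom (z (r j)) \<alpha> / of_real (M j \<beta>)) \<longlonglongrightarrow> zmonom u \<alpha>"
        unfolding mono by (simp only: if_False) }
    { assume "wdeg w \<beta> < wdeg w \<alpha>"
      then show "(\<lambda>j. zmonom (z (r j)) \<alpha> / of_real (M j \<beta>)) \<longlonglongrightarrow> 0"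
        unfolding mono using gr[OF E] by (cases "\<exists>i. i \<notin> J \<and> 0 < \<alpha> i") (simp_all only: if_True if_False div_0 tendsto_const) }
  qed
qed

section \<open>Newton polyhedra\<close>

lemma wlin_exp_vec: "wlin w (exp_vec \<alpha>) = real (wdeg w \<alpha>)"
  by (simp add: wlin_def exp_vec_def wdeg_def)

lemma wlin_inner: "wlin w x = (\<chi> i. real (w i)) \<bullet> x"
  by (simp add: wlin_def inner_vec_def)

lemma wlin_mono: "(\<And>i. x $ i \<le> y $ i) \<Longrightarrow> wlin w x \<le> wlin w y"
  unfolding wlin_def by (intro sum_mono mult_left_mono) auto

lemma exp_vec_in_newton_polyhedron: "\<alpha> \<in> zsupp c \<Longrightarrow> exp_vec \<alpha> \<in> newton_polyhedron c"
  unfolding newton_polyhedron_def by (rule hull_inc) auto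

lemma wlin_ge_on_newton_polyhedron:
  assumes "\<And>\<alpha>. \<alpha> \<in> zsupp c \<Longrightarrow> m \<le> real (wdeg w \<alpha>)" and "x \<in> newton_polyhedron c"
  shows "m \<le> wlin w x"
proof -
  have "newton_polyhedron c \<subseteq> {x. wlin w x \<ge> m}"
    unfolding newton_polyhedron_def
  proof (rule hull_minimal)
    show "convex {x. wlin w x \<ge> m}" unfolding wlin_inner by (rule convex_halfspace_ge)
    show "(\<Union>\<alpha>\<in>zsupp c. {x. \<forall>i. exp_vec \<alpha> $ i \<le> x $ i}) \<subseteq> {x. m \<le> wlin w x}"
    proof safe
      fix \<alpha> x assume "\<alpha> \<in> zsupp c" "\<forall>i. exp_vec \<alpha> $ i \<le> x $ i"
      then show "m \<le> wlin w x"
        using assms(1)[of \<alpha>] wlin_mono[of "exp_vec \<alpha>" x w] by (simp add: wlin_exp_vec)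
    qed
  qed
  then show ?thesis using assms(2) by blast
qed

definition wdeg_min :: "('n::finite \<Rightarrow> nat) \<Rightarrow> 'n zpoly \<Rightarrow> ('n \<Rightarrow> nat) \<Rightarrow> bool" where
  "wdeg_min w c \<alpha>0 \<longleftrightarrow> \<alpha>0 \<in> zsupp c \<and> (\<forall>\<alpha>\<in>zsupp c. wdeg w \<alpha>0 \<le> wdeg w \<alpha>)"

lemma wdeg_minD:
  assumes "wdeg_min w c \<alpha>0"
  shows "\<alpha>0 \<in> zsupp c" "\<alpha> \<in> zsupp c \<Longrightarrow> wdeg w \<alpha>0 \<le> wdeg w \<alpha>"
  using assms by (auto simp: wdeg_min_def)

lemma newton_d_eq_Min:
  assumes "wdeg_min w c \<alpha>0"
  shows "newton_d w c = real (wdeg w \<alpha>0)"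
  unfolding newton_d_def
proof (rule cInf_eq_minimum)
  show "real (wdeg w \<alpha>0) \<in> wlin w ` newton_polyhedron c"
    using exp_vec_in_newton_polyhedron[OF wdeg_minD(1)[OF assms]] by (metis imageI wlin_exp_vec)
  show "real (wdeg w \<alpha>0) \<le> y" if "y \<in> wlin w ` newton_polyhedron c" for y
    using that wdeg_minD(2)[OF assms] by (auto intro!: wlin_ge_on_newton_polyhedron)
qed

lemma face_fun_eq:
  assumes "wdeg_min w c \<alpha>0"
  shows "face_fun w c \<alpha> = (if wdeg w \<alpha> = wdeg w \<alpha>0 then c \<alpha> else 0)"
  using exp_vec_in_newton_polyhedron[of \<alpha> c]
  by (auto simp: face_fun_def newton_face_def newton_d_eq_Min[OF assms] wlin_exp_vec zsupp_def)

lemma exists_min_wdeg: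
  assumes "zsupp c \<noteq> {}"
  obtains \<alpha>0 where "wdeg_min w c \<alpha>0"
  using that assms ex_has_least_nat[of "\<lambda>\<alpha>. \<alpha> \<in> zsupp c" _ "wdeg w"] unfolding wdeg_min_def by blast

text \<open>The hull of the minimal exponents together with the open half-space above them is
  convex. It contains the generating orthants because, all weights being positive, a point of an
  orthant has the weight of its apex only if it is the apex.\<close>

lemma newton_face_eq_hull:
  assumes pos: "\<And>i. w i > 0" and min: "wdeg_min w c \<alpha>0"
  shows "newton_face w c = convex hull (exp_vec ` {\<alpha> \<in> zsupp c. wdeg w \<alpha> = wdeg w \<alpha>0})"
    (is "_ = convex hull ?V")
proof
  let ?d = "real (wdeg w \<alpha>0)"
  let ?P = "convex hull ?V \<union> {x. wlin w x > ?d}"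
  have H: "convex hull ?V \<subseteq> {x. wlin w x = ?d}"
    by (rule hull_minimal) (auto simp: wlin_exp_vec, simp add: wlin_inner convex_hyperplane)
  have "convex ?P"
  proof (rule convexI)
    fix x y and a b :: real
    assume x: "x \<in> ?P" and y: "y \<in> ?P" and ab: "0 \<le> a" "0 \<le> b" "a + b = 1"
    have lin: "wlin w (a *\<^sub>R x + b *\<^sub>R y) = a * wlin w x + b * wlin w y"
      by (simp add: wlin_inner inner_add_right)
    have ge: "wlin w x \<ge> ?d" "wlin w y \<ge> ?d" using x y H by auto
    show "a *\<^sub>R x + b *\<^sub>R y \<in> ?P"
    proof (cases "a * (wlin w x - ?d) + b * (wlin w y - ?d) > 0")
      case True
      then have "wlin w (a *\<^sub>R x + b *\<^sub>R y) > (a + b) * ?d" unfolding lin by (simp add: algebra_simps)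
      then show ?thesis using ab by simp
    next
      case False
      moreover have "a * (wlin w x - ?d) \<ge> 0" "b * (wlin w y - ?d) \<ge> 0" using ge ab by auto
      ultimately have z: "a * (wlin w x - ?d) = 0" "b * (wlin w y - ?d) = 0" by linarith+
      consider "a = 0" | "b = 0" | "wlin w x = ?d" "wlin w y = ?d" using z by auto
      then show ?thesis
      proof cases
        case 3
        then have "x \<in> convex hull ?V" "y \<in> convex hull ?V" using x y by auto
        then show ?thesis using convexD[OF convex_convex_hull _ _ ab] by blast
      qed (use x y ab in auto)
    qed
  qed
  moreover have "(\<Union>\<alpha>\<in>zsupp c. {x. \<forall>i. x $ i \<ge> exp_vec \<alpha> $ i}) \<subseteq> ?P"
  proof (rule subsetI, rule UnCI)
    fix x assume "x \<in> (\<Union>\<alpha>\<in>zsupp c. {x. \<forall>i. x $ i \<ge> exp_vec \<alpha> $ i})" and "x \<notin> {x. wlin w x > ?d}"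
    then obtain \<alpha> where a: "\<alpha> \<in> zsupp c" and x: "\<forall>i. exp_vec \<alpha> $ i \<le> x $ i" and n: "\<not> wlin w x > ?d"
      by auto
    have "wlin w x = ?d" "wlin w (exp_vec \<alpha>) = ?d"
      using wlin_mono[of "exp_vec \<alpha>" x w] x n wdeg_minD(2)[OF min a] by (auto simp: wlin_exp_vec)
    then have "(\<Sum>i\<in>UNIV. real (w i) * (x $ i - exp_vec \<alpha> $ i)) = 0"
      by (simp add: wlin_def right_diff_distrib sum_subtractf)
    then have "x $ i = exp_vec \<alpha> $ i" for i
      using x pos[of i] by (subst (asm) sum_nonneg_eq_0_iff) (auto dest: spec[of _ i])
    then have "x = exp_vec \<alpha>" by (simp add: vec_eq_iff)
    moreover have "wdeg w \<alpha> = wdeg w \<alpha>0" using \<open>wlin w (exp_vec \<alpha>) = ?d\<close> by (simp add: wlin_exp_vec)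
    ultimately show "x \<in> convex hull ?V" using a by (auto intro!: hull_inc)
  qed
  ultimately have "newton_polyhedron c \<subseteq> ?P"
    unfolding newton_polyhedron_def by (intro hull_minimal)
  then show "newton_face w c \<subseteq> convex hull ?V"
    by (auto simp: newton_face_def newton_d_eq_Min[OF min])
  have "convex hull ?V \<subseteq> newton_polyhedron c"
    by (rule hull_minimal) (use exp_vec_in_newton_polyhedron in blast, simp add: newton_polyhedron_def)
  then show "convex hull ?V \<subseteq> newton_face w c"
    using H by (auto simp: newton_face_def newton_d_eq_Min[OF min])
qed

text \<open>The assumption on Newton boundaries sees compact faces only; this inclusion connects it
  with weighted degrees.\<close>

lemma newton_face_subset_boundary:
  assumes fin: "finite (zsupp c)" and pos: "\<And>i. w i > 0" 
    and min: "wdeg_min w c \<alpha>0"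
  shows "newton_face w c \<subseteq> newton_boundary c"
proof -
  have "compact (newton_face w c)"
    unfolding newton_face_eq_hull[OF assms(2-)] using fin
    by (intro finite_imp_compact_convex_hull) auto
  moreover have "newton_face w c face_of newton_polyhedron c"
  proof -
    have "newton_polyhedron c \<inter> {x. (\<chi> i. real (w i)) \<bullet> x = real (wdeg w \<alpha>0)} face_of newton_polyhedron c"
    proof (rule face_of_Int_supporting_hyperplane_ge)
      show "convex (newton_polyhedron c)" by (simp add: newton_polyhedron_def)
      show "(\<chi> i. real (w i)) \<bullet> x \<ge> real (wdeg w \<alpha>0)" if "x \<in> newton_polyhedron c" for x
        unfolding wlin_inner[symmetric] using wlin_ge_on_newton_polyhedron[OF _ that] wdeg_minD(2)[OF min] by simp
    qed
    then show ?thesis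
      by (simp add: newton_face_def newton_d_eq_Min[OF min] wlin_inner Int_def)
  qed
  ultimately show ?thesis unfolding newton_boundary_def by blast
qed

lemma newton_boundary_subset: "newton_boundary c \<subseteq> newton_polyhedron c"
  unfolding newton_boundary_def using face_of_imp_subset by blast

text \<open>Only strictly positive weights have compact faces; the general case is reached through
  the weights \<open>N w + 1\<close> as \<open>N\<close> grows.\<close>
lemma newton_boundary_eq_imp_wdeg_le:
  assumes fin: "finite (zsupp c)" "finite (zsupp c')" and ne: "zsupp c \<noteq> {}"
    and bd: "newton_boundary c = newton_boundary c'" and \<alpha>: "\<alpha> \<in> zsupp c'"
  shows "\<exists>\<beta>\<in>zsupp c. wdeg w \<beta> \<le> wdeg w \<alpha>"
proof (rule ccontr)
  assume neg: "\<not> ?thesis"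
  \<comment> \<open>\<open>N\<close> exceeds the total degree of \<open>\<alpha>\<close>, so a gap
    of 1 in \<open>w\<close>-degree outweighs the perturbation by the constant weight 1. If all
    exponents of \<open>c\<close> were heavier than \<open>\<alpha>\<close> for \<open>w\<close>,
    they would be so for \<open>v\<close>; but the \<open>v\<close>-minimal exponent of
    \<open>c'\<close> lies in the polyhedron of \<open>c\<close>.\<close>
  define N where "N = (\<Sum>i\<in>UNIV. \<alpha> i) + 1"
  define v where "v i = N * w i + 1" for i
  have pos: "v i > 0" for i by (simp add: v_def)
  have v: "wdeg v \<beta> = N * wdeg w \<beta> + (\<Sum>i\<in>UNIV. \<beta> i)" for \<beta>
    by (simp add: wdeg_def v_def sum_distrib_left algebra_simps sum.distrib)
  obtain \<gamma> where \<gamma>: "wdeg_min v c' \<gamma>"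
    using exists_min_wdeg[of c' v] \<alpha> by blast
  have "exp_vec \<gamma> \<in> newton_face v c'"
    using exp_vec_in_newton_polyhedron[OF wdeg_minD(1)[OF \<gamma>]] by (simp add: newton_face_def newton_d_eq_Min[OF \<gamma>] wlin_exp_vec)
  then have "exp_vec \<gamma> \<in> newton_polyhedron c"
    using newton_face_subset_boundary[OF fin(2) pos \<gamma>] newton_boundary_subset[of c] bd by blast
  moreover obtain \<beta> where \<beta>: "wdeg_min v c \<beta>"
    using exists_min_wdeg[OF ne, of v] by blast
  ultimately have "wdeg v \<beta> \<le> wdeg v \<gamma>"
    using wlin_ge_on_newton_polyhedron[of c "real (wdeg v \<beta>)" v "exp_vec \<gamma>"] wdeg_minD(2)[OF \<beta>] by (simp add: wlin_exp_vec)
  also have "\<dots> \<le> wdeg v \<alpha>" by (rule wdeg_minD(2)[OF \<gamma> \<alpha>])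
  finally have "N * wdeg w \<beta> \<le> N * wdeg w \<alpha> + (\<Sum>i\<in>UNIV. \<alpha> i)" unfolding v by linarith
  moreover have "N * (wdeg w \<alpha> + 1) \<le> N * wdeg w \<beta>" 
    using neg wdeg_minD(1)[OF \<beta>] by (intro mult_left_mono) (auto simp: not_le Suc_le_eq)
  ultimately show False by (simp add: N_def algebra_simps)
qed

section \<open>Face functions and logarithmic derivatives\<close>

lemma zmonom_update:
  "zmonom (\<chi> j. if j = i then x else z $ j) \<alpha> = x ^ \<alpha> i * (\<Prod>j\<in>UNIV - {i}. z $ j ^ \<alpha> j)"
  unfolding zmonom_def by (subst prod.remove[of UNIV i]) (auto intro!: prod.cong)

text \<open>The support of \<open>slice P t\<close> changes with \<open>t\<close>. Summing over a
  fixed finite set of exponents allows limits to be taken term by term.\<close>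

lemma zeval_eq_sum:
  assumes "finite A" "zsupp c \<subseteq> A"
  shows "zeval c z = (\<Sum>\<alpha>\<in>A. c \<alpha> * zmonom z \<alpha>)"
  unfolding zeval_def zmonom_def
  by (rule sum.mono_neutral_left) (use assms in \<open>auto simp: zsupp_def\<close>)

lemma zeval_has_partial:
  assumes "finite (zsupp c)"
  shows "((\<lambda>x. zeval c (\<chi> j. if j = i then x else z $ j)) has_field_derivative cgrad (zeval c) z $ i) (at (z $ i))"
    and "z $ i * cgrad (zeval c) z $ i = (\<Sum>\<alpha>\<in>zsupp c. c \<alpha> * of_nat (\<alpha> i) * zmonom z \<alpha>)"
proof -
  define D where "D = (\<Sum>\<alpha>\<in>zsupp c. c \<alpha> * ((of_nat (\<alpha> i) * z $ i ^ (\<alpha> i - 1)) * (\<Prod>j\<in>UNIV - {i}. z $ j ^ \<alpha> j)))"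
  have "((\<lambda>x. \<Sum>\<alpha>\<in>zsupp c. c \<alpha> * (x ^ \<alpha> i * (\<Prod>j\<in>UNIV - {i}. z $ j ^ \<alpha> j))) has_field_derivative D) (at (z $ i))"
    unfolding D_def by (auto intro!: derivative_eq_intros sum.cong)
  then have d: "((\<lambda>x. zeval c (\<chi> j. if j = i then x else z $ j)) has_field_derivative D) (at (z $ i))"
    unfolding zeval_eq_sum[OF assms order_refl] zmonom_update .
  then have D: "cgrad (zeval c) z $ i = D" by (simp add: cgrad_def cpartial_def DERIV_imp_deriv)
  with d show "((\<lambda>x. zeval c (\<chi> j. if j = i then x else z $ j)) has_field_derivative cgrad (zeval c) z $ i) (at (z $ i))"
    by simp
  have "z $ i * (c \<alpha> * ((of_nat (\<alpha> i) * z $ i ^ (\<alpha> i - 1)) * (\<Prod>j\<in>UNIV - {i}. z $ j ^ \<alpha> j)))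
     = c \<alpha> * of_nat (\<alpha> i) * zmonom z \<alpha>" for \<alpha>
  proof (cases "\<alpha> i")
    case (Suc m)
    have "zmonom z \<alpha> = z $ i ^ \<alpha> i * (\<Prod>j\<in>UNIV - {i}. z $ j ^ \<alpha> j)"
      unfolding zmonom_def by (rule prod.remove) auto
    then show ?thesis using Suc by simp
  qed simp
  then show "z $ i * cgrad (zeval c) z $ i = (\<Sum>\<alpha>\<in>zsupp c. c \<alpha> * of_nat (\<alpha> i) * zmonom z \<alpha>)"
    unfolding D D_def sum_distrib_left by (intro sum.cong refl)
qed

lemma log_partial_eq_sum:
  assumes "finite A" "zsupp c \<subseteq> A"
  shows "z $ i * cgrad (zeval c) z $ i = (\<Sum>\<alpha>\<in>A. c \<alpha> * of_nat (\<alpha> i) * zmonom z \<alpha>)"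
proof -
  have "finite (zsupp c)" using assms finite_subset by blast
  then show ?thesis unfolding zeval_has_partial(2)[OF \<open>finite (zsupp c)\<close>]
    by (intro sum.mono_neutral_left) (use assms in \<open>auto simp: zsupp_def\<close>)
qed

lemma zsupp_face_fun: "zsupp (face_fun w c) \<subseteq> zsupp c"
  by (auto simp: zsupp_def face_fun_def)

lemma euler_face_fun:
  assumes fin: "finite (zsupp c)" and ne: "zsupp c \<noteq> {}"
  shows "(\<Sum>i\<in>UNIV. of_nat (w i) * (u $ i * cgrad (zeval (face_fun w c)) u $ i))
     = of_real (newton_d w c) * zeval (face_fun w c) u"
proof -
  obtain \<alpha>0 where min: "wdeg_min w c \<alpha>0"
    using exists_min_wdeg[OF ne] by blast
  have "(\<Sum>i\<in>UNIV. of_nat (w i) * (u $ i * cgrad (zeval (face_fun w c)) u $ i))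
      = (\<Sum>i\<in>UNIV. \<Sum>\<alpha>\<in>zsupp c. of_nat (w i * \<alpha> i) * (face_fun w c \<alpha> * zmonom u \<alpha>))"
    unfolding log_partial_eq_sum[OF fin zsupp_face_fun] by (simp add: sum_distrib_left mult_ac)
  also have "\<dots> = (\<Sum>\<alpha>\<in>zsupp c. of_nat (wdeg w \<alpha>) * (face_fun w c \<alpha> * zmonom u \<alpha>))"
    by (subst sum.swap) (simp add: wdeg_def sum_distrib_right)
  also have "\<dots> = (\<Sum>\<alpha>\<in>zsupp c. of_nat (wdeg w \<alpha>0) * (face_fun w c \<alpha> * zmonom u \<alpha>))"
    by (intro sum.cong refl) (simp add: face_fun_eq[OF min])
  also have "\<dots> = of_real (newton_d w c) * zeval (face_fun w c) u"
    unfolding zeval_eq_sum[OF fin zsupp_face_fun] newton_d_eq_Min[OF min] by (simp add: sum_distrib_left)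
  finally show ?thesis .
qed

lemma zeval_vanishes:
  fixes c :: "'n::finite zpoly"
  assumes "finite (zsupp c)" "\<And>\<alpha>. \<alpha> \<in> zsupp c \<Longrightarrow> \<exists>i. i \<notin> J \<and> \<alpha> i > 0"
  shows "vanishes_on_coord (zeval c) J"
  unfolding vanishes_on_coord_def zeval_eq_sum[OF assms(1) order_refl]
proof (intro allI impI sum.neutral ballI)
  fix z :: "complex ^ 'n" and \<alpha> assume "\<forall>i. i \<notin> J \<longrightarrow> z $ i = 0" "\<alpha> \<in> zsupp c"
  then have "zmonom z \<alpha> = 0" unfolding zmonom_eq_0_iff using assms(2) by blast
  then show "c \<alpha> * zmonom z \<alpha> = 0" by simp
qed

lemma wdeg_eq_0_iff: "wdeg w \<alpha> = 0 \<longleftrightarrow> (\<forall>i. w i > 0 \<longrightarrow> \<alpha> i = 0)"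
  unfolding wdeg_def by (auto, metis neq0_conv)

text \<open>If a monomial of weight 0 occurs, the face function is the restriction to the coordinate
  subspace on which the weight vanishes.\<close>
lemma face_fun_weight_zero:
  assumes fin: "finite (zsupp c)" and \<alpha>: "\<alpha>0 \<in> zsupp c" "wdeg w \<alpha>0 = 0"
    and u: "\<And>i. w i = 0 \<Longrightarrow> u $ i = z $ i" and z: "\<And>i. w i > 0 \<Longrightarrow> z $ i = 0"
  shows "zeval (face_fun w c) u = zeval c z"
    and "u $ i * cgrad (zeval (face_fun w c)) u $ i = z $ i * cgrad (zeval c) z $ i"
proof -
  have min: "wdeg_min w c \<alpha>0" using \<alpha> by (simp add: wdeg_min_def)
  \<comment> \<open>The factor \<open>x\<close> makes one identity serve the values
    (\<open>x\<close> is 1) and the logarithmic derivatives (\<open>x\<close> is an exponent). A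
    monomial of weight 0 uses only coordinates where \<open>u\<close> and \<open>z\<close> agree;
    any other one vanishes at \<open>z\<close>.\<close>
  have eq: "face_fun w c \<alpha> * (x * zmonom u \<alpha>) = c \<alpha> * (x * zmonom z \<alpha>)" for x \<alpha>
  proof (cases "wdeg w \<alpha> = 0")
    case True
    then have "zmonom u \<alpha> = zmonom z \<alpha>"
      unfolding zmonom_def using u by (intro prod.cong refl) (metis wdeg_eq_0_iff neq0_conv power_0)
    then show ?thesis using True \<alpha> by (simp add: face_fun_eq[OF min])
  next
    case False
    then have "zmonom z \<alpha> = 0" using z by (auto simp: wdeg_eq_0_iff zmonom_eq_0_iff)
    then show ?thesis using False \<alpha> by (simp add: face_fun_eq[OF min])
  qed
  show "zeval (face_fun w c) u = zeval c z"
    unfolding zeval_eq_sum[OF fin zsupp_face_fun] zeval_eq_sum[OF fin order_refl]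
    using eq[of _ 1] by simp
  show "u $ i * cgrad (zeval (face_fun w c)) u $ i = z $ i * cgrad (zeval c) z $ i"
    unfolding log_partial_eq_sum[OF fin zsupp_face_fun] log_partial_eq_sum[OF fin order_refl]
    by (simp add: mult.assoc eq)
qed

section \<open>Polynomials depending on the parameter\<close>

definition tz_exps :: "'n tzpoly \<Rightarrow> ('n \<Rightarrow> nat) set" where
  "tz_exps P = {\<alpha>. \<exists>j. P j \<alpha> \<noteq> 0}"

lemma finite_tz_exps: "is_tzpoly P \<Longrightarrow> finite (tz_exps P)"
proof -
  assume "is_tzpoly P"
  then have "finite (snd ` {(j, \<alpha>). P j \<alpha> \<noteq> 0})" by (simp add: is_tzpoly_def)
  moreover have "tz_exps P = snd ` {(j, \<alpha>). P j \<alpha> \<noteq> 0}" by (force simp: tz_exps_def)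
  ultimately show ?thesis by simp
qed

lemma zsupp_slice: "zsupp (slice P t) \<subseteq> tz_exps P"
  by (auto simp: zsupp_def slice_def tz_exps_def intro: ccontr)

lemma finite_zsupp_slice: "is_tzpoly P \<Longrightarrow> finite (zsupp (slice P t))"
  by (rule finite_subset[OF zsupp_slice finite_tz_exps])

lemma tzeval_eq_zeval_slice:
  assumes "is_tzpoly P"
  shows "tzeval P t z = zeval (slice P t) z"
proof -
  have fin: "finite {j. P j \<alpha> \<noteq> 0}" for \<alpha>
  proof -
    have "finite (fst ` {(j, \<alpha>). P j \<alpha> \<noteq> 0})" using assms by (simp add: is_tzpoly_def)
    then show ?thesis by (rule finite_subset[rotated]) force
  qed
  have "zeval (slice P t) z = (\<Sum>\<alpha>\<in>tz_exps P. \<Sum>j\<in>{j. P j \<alpha> \<noteq> 0}. P j \<alpha> * t ^ j * zmonom z \<alpha>)"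
    unfolding zeval_eq_sum[OF finite_tz_exps[OF assms] zsupp_slice] by (simp add: slice_def sum_distrib_right)
  also have "\<dots> = (\<Sum>(\<alpha>, j)\<in>Sigma (tz_exps P) (\<lambda>\<alpha>. {j. P j \<alpha> \<noteq> 0}). P j \<alpha> * t ^ j * zmonom z \<alpha>)"
    using finite_tz_exps[OF assms] fin by (intro sum.Sigma) auto
  also have "\<dots> = tzeval P t z"
    unfolding tzeval_def zmonom_def
    by (rule sum.reindex_bij_witness[where i = prod.swap and j = prod.swap]) (auto simp: tz_exps_def)
  finally show ?thesis ..
qed

lemma tendsto_slice: "(t \<longlongrightarrow> t0) G \<Longrightarrow> ((\<lambda>j. slice P (t j) \<alpha>) \<longlongrightarrow> slice P t0 \<alpha>) G"
  unfolding slice_def by (intro tendsto_intros)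

lemma tendsto_zeval_slice:
  assumes "is_tzpoly P" "(t \<longlongrightarrow> t0) G" "(z \<longlongrightarrow> z0) G"
  shows "((\<lambda>j. zeval (slice P (t j)) (z j)) \<longlongrightarrow> zeval (slice P t0) z0) G"
  unfolding zeval_eq_sum[OF finite_tz_exps[OF assms(1)] zsupp_slice]
  by (intro tendsto_intros tendsto_slice tendsto_zmonom assms)

section \<open>Limits of subsequences and transversality of hyperplanes\<close>

text \<open>Division by the sum of the moduli puts the coefficients on a compact unit sphere, so
  that a limit exists and cannot be zero.\<close>

lemma normalized_subsequence:
  fixes c :: "'x \<Rightarrow> nat \<Rightarrow> complex"
  assumes fin: "finite X" and pos: "\<And>j. (\<Sum>x\<in>X. cmod (c x j)) > 0"
  obtains r l where "strict_mono (r :: nat \<Rightarrow> nat)" "\<exists>x\<in>X. l x \<noteq> 0"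
    "\<And>x. x \<in> X \<Longrightarrow> (\<lambda>j. c x (r j) / of_real (\<Sum>x\<in>X. cmod (c x (r j)))) \<longlonglongrightarrow> l x"
proof -
  define s where "s j = (\<Sum>x\<in>X. cmod (c x j))" for j
  have s: "s j > 0" for j using pos by (simp add: s_def)
  have "bounded (range (\<lambda>j. c x j / of_real (s j)))" if x: "x \<in> X" for x
  proof -
    have "cmod (c x j) \<le> s j" for j
      unfolding s_def by (rule member_le_sum[OF x _ fin]) simp
    then have "cmod (c x j / of_real (s j)) \<le> 1" for j
      using s[of j] by (simp add: norm_divide)
    then show ?thesis by (auto simp: bounded_iff)
  qed
  then obtain r l where r: "strict_mono r" and l: "\<And>x. x \<in> X \<Longrightarrow> (\<lambda>j. c x (r j) / of_real (s (r j))) \<longlonglongrightarrow> l x"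
    using common_bounded_limits[OF fin, of "\<lambda>x j. c x j / of_real (s j)"] by blast
  have "(\<lambda>j. \<Sum>x\<in>X. cmod (c x (r j) / of_real (s (r j)))) \<longlonglongrightarrow> (\<Sum>x\<in>X. cmod (l x))"
    by (intro tendsto_intros l)
  moreover have "(\<Sum>x\<in>X. cmod (c x (r j) / of_real (s (r j)))) = 1" for j
    using s[of "r j"] by (simp add: norm_divide sum_divide_distrib[symmetric] s_def[symmetric])
  ultimately have "(\<Sum>x\<in>X. cmod (l x)) = 1" by (simp add: LIMSEQ_const_iff)
  then have "\<exists>x\<in>X. l x \<noteq> 0" by (metis norm_zero sum.neutral zero_neq_one)
  with r l show thesis unfolding s_def using that by blast
qed

text \<open>The sum of the moduli has, along a subsequence, a finite or an infinite limit. In the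
  infinite case it serves as the divisor \<open>\<Lambda>\<close>, so that any coefficient that
  stays bounded contributes nothing to the limit.\<close>

lemma bounded_or_normalized_subsequence:
  fixes c :: "'x \<Rightarrow> nat \<Rightarrow> complex"
  assumes fin: "finite X"
  obtains (bounded) r l where "strict_mono (r :: nat \<Rightarrow> nat)" "\<And>x. x \<in> X \<Longrightarrow> (\<lambda>j. c x (r j)) \<longlonglongrightarrow> l x"
  | (unbounded) r l \<Lambda> where "strict_mono (r :: nat \<Rightarrow> nat)" "filterlim \<Lambda> at_top sequentially"
    "\<And>x. x \<in> X \<Longrightarrow> (\<lambda>j. c x (r j) / of_real (\<Lambda> j)) \<longlonglongrightarrow> l x" "\<exists>x\<in>X. l x \<noteq> 0"
proof -
  define s where "s j = (\<Sum>x\<in>X. cmod (c x j))" for j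
  have cs: "cmod (c x j) \<le> s j" if "x \<in> X" for x j
    unfolding s_def by (rule member_le_sum[OF that _ fin]) simp
  have s0: "s j \<ge> 0" for j unfolding s_def by (intro sum_nonneg) simp
  obtain L r1 where r1: "strict_mono (r1 :: nat \<Rightarrow> nat)" and L: "((\<lambda>j. ereal (s j)) \<circ> r1) \<longlonglongrightarrow> L"
    using compact_complete_linorder by blast
  have L0: "L \<ge> 0" by (rule LIMSEQ_le_const[OF L]) (simp add: s0)
  show thesis
  proof (cases "L = \<infinity>")
    case False
    then obtain a where "L = ereal a" using L0 by (cases L) auto
    then have "(\<lambda>j. s (r1 j)) \<longlonglongrightarrow> a" using L by (simp add: o_def)
    then obtain B where B: "\<And>j. \<bar>s (r1 j)\<bar> \<le> B"
      using convergent_imp_bounded by (fastforce simp: bounded_iff)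
    have "bounded (range (\<lambda>j. c x (r1 j)))" if "x \<in> X" for x
      unfolding bounded_iff using cs[OF that] order_trans[OF _ order_trans[OF abs_ge_self B]] by blast
    then obtain r2 l where r2: "strict_mono r2" "\<And>x. x \<in> X \<Longrightarrow> (\<lambda>j. c x (r1 (r2 j))) \<longlonglongrightarrow> l x"
      using common_bounded_limits[OF fin, of "\<lambda>x j. c x (r1 j)"] by blast
    show thesis
      by (rule bounded[of "r1 \<circ> r2" l]) (use r1 r2 strict_mono_o in auto)
  next
    case True
    then have top: "filterlim (\<lambda>j. s (r1 j)) at_top sequentially"
      using L by (simp add: o_def tendsto_PInfty_eq_at_top)
    then have "eventually (\<lambda>j. s (r1 j) > 0) sequentially" by (simp add: filterlim_at_top_dense)
    then obtain n where n: "\<And>j. j \<ge> n \<Longrightarrow> s (r1 j) > 0" by (auto simp: eventually_sequentially)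
    then have pos: "\<And>j. (\<Sum>x\<in>X. cmod (c x (r1 (j + n)))) > 0" by (simp add: s_def)
    obtain r2 l where r2: "strict_mono (r2 :: nat \<Rightarrow> nat)" and l: "\<exists>x\<in>X. l x \<noteq> 0"
      "\<And>x. x \<in> X \<Longrightarrow> (\<lambda>j. c x (r1 (r2 j + n)) / of_real (\<Sum>x\<in>X. cmod (c x (r1 (r2 j + n))))) \<longlonglongrightarrow> l x"
      by (rule normalized_subsequence[of X "\<lambda>x j. c x (r1 (j + n))", OF fin pos]) (rule that)
    note l = l[folded s_def]
    have sm: "strict_mono (\<lambda>j. r1 (r2 j + n))" "strict_mono (\<lambda>j. r2 j + n)"
      using r1 r2 by (auto simp: strict_mono_def)
    have "filterlim (\<lambda>j. s (r1 (r2 j + n))) at_top sequentially"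
      by (rule filterlim_compose[OF top filterlim_subseq[OF sm(2)]])
    then show thesis using unbounded[OF sm(1)] l by blast
  qed
qed

text \<open>Allows the zero pattern of the coordinates, and a set of factors, to be fixed before a
  sequence of counterexamples is chosen.\<close>

lemma finite_uniform_radius:
  fixes P :: "'x \<Rightarrow> real \<Rightarrow> bool"
  assumes "finite X" and "\<And>x. x \<in> X \<Longrightarrow> \<exists>\<rho>>0. P x \<rho>"
    and "\<And>x \<rho> \<rho>'. P x \<rho> \<Longrightarrow> 0 < \<rho>' \<Longrightarrow> \<rho>' \<le> \<rho> \<Longrightarrow> P x \<rho>'"
  shows "\<exists>\<rho>>0. \<forall>x\<in>X. P x \<rho>"
proof -
  obtain \<rho> where \<rho>: "\<And>x. x \<in> X \<Longrightarrow> \<rho> x > 0 \<and> P x (\<rho> x)" using assms(2) by metis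
  define m where "m = Min (insert 1 (\<rho> ` X))"
  have "m > 0" unfolding m_def using assms(1) \<rho> by auto
  moreover have "m \<le> \<rho> x" if "x \<in> X" for x unfolding m_def using assms(1) that by auto
  ultimately show ?thesis using \<rho> assms(3) by blast
qed

lemma small_sequence:
  fixes z :: "nat \<Rightarrow> 'a::real_normed_vector"
  assumes "\<And>n. norm (z n) \<le> a / real (Suc n)"
  shows "z \<longlonglongrightarrow> 0"
proof (rule Lim_null_comparison)
  show "eventually (\<lambda>n. norm (z n) \<le> a / real (Suc n)) sequentially" using assms by simp
  show "(\<lambda>n. a / real (Suc n)) \<longlonglongrightarrow> 0" by (rule lim_const_over_n[THEN LIMSEQ_Suc])
qed

text \<open>If \<open>g\<close> is not a multiple of the conjugate of \<open>z\<close>, some vector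
  \<open>a0\<close> in the kernel of \<open>g\<close> has nonzero Hermitian product with
  \<open>z\<close>. A complex multiple of it takes up the whole product of \<open>v\<close> with
  \<open>z\<close>.\<close>

lemma hyperplane_transverse:
  fixes g z v :: "complex ^ 'n::finite"
  assumes "g \<noteq> 0" "z \<noteq> 0" and npar: "\<not> (\<exists>\<mu>. \<forall>i. g $ i = \<mu> * cnj (z $ i))"
  shows "\<exists>a b. v = a + b \<and> (\<Sum>i\<in>UNIV. g $ i * a $ i) = 0 \<and> Re (\<Sum>i\<in>UNIV. b $ i * cnj (z $ i)) = 0"
proof -
  obtain p where p: "g $ p \<noteq> 0" using assms(1) by (auto simp: vec_eq_iff)
  obtain q where q: "cnj (z $ q) * g $ p \<noteq> g $ q * cnj (z $ p)"
  proof (rule ccontr)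
    assume "\<not> thesis"
    then have par: "cnj (z $ i) * g $ p = g $ i * cnj (z $ p)" for i using that by blast
    have "z $ p \<noteq> 0"
    proof
      assume "z $ p = 0"
      then have "z $ i = 0" for i using par[of i] p by simp
      then show False using assms(2) by (simp add: vec_eq_iff)
    qed
    then have "g $ i = (g $ p / cnj (z $ p)) * cnj (z $ i)" for i using par[of i] by (simp add: field_simps)
    then show False using npar by blast
  qed
  \<comment> \<open>Supported on two coordinates, \<open>a0\<close> is killed by \<open>g\<close>,
    and pairing it with the conjugate of \<open>z\<close> yields the 2 by 2 minor that is nonzero by
    the choice of \<open>q\<close>.\<close>
  define a0 :: "complex ^ 'n" where "a0 = (\<chi> j. (if j = q then g $ p else 0) - (if j = p then g $ q else 0))"
  have s: "(\<Sum>j\<in>UNIV. x j * a0 $ j) = x q * g $ p - x p * g $ q" for x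
  proof -
    have "x j * a0 $ j = (if j = q then x q * g $ p else 0) - (if j = p then x p * g $ q else 0)" for j
      by (auto simp: a0_def algebra_simps)
    then show ?thesis by (simp add: sum_subtractf)
  qed
  define D where "D = (\<Sum>j\<in>UNIV. cnj (z $ j) * a0 $ j)"
  have D: "D \<noteq> 0" using q unfolding D_def s by (simp add: mult.commute)
  define c where "c = (\<Sum>j\<in>UNIV. v $ j * cnj (z $ j)) / D"
  define a :: "complex ^ 'n" where "a = (\<chi> j. c * a0 $ j)"
  have "(\<Sum>i\<in>UNIV. g $ i * a $ i) = c * (\<Sum>i\<in>UNIV. g $ i * a0 $ i)"
    by (simp add: a_def sum_distrib_left mult_ac)
  also have "\<dots> = 0" unfolding s by simp
  finally have 1: "(\<Sum>i\<in>UNIV. g $ i * a $ i) = 0" .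
  have "(\<Sum>i\<in>UNIV. a $ i * cnj (z $ i)) = c * D"
    by (simp add: a_def D_def sum_distrib_left mult_ac)
  then have "(\<Sum>i\<in>UNIV. (v - a) $ i * cnj (z $ i)) = 0"
    using D by (simp add: c_def left_diff_distrib sum_subtractf)
  then show ?thesis using 1 by (intro exI[of _ a] exI[of _ "v - a"]) simp
qed

section \<open>Newton-admissible families\<close>

locale newton_family =
  fixes k0 :: nat and F :: "nat \<Rightarrow> 'n::finite tzpoly" and \<tau>0 R :: real
  assumes poly: "k \<in> {1..k0} \<Longrightarrow> is_tzpoly (F k)"
    and vanish_0: "k \<in> {1..k0} \<Longrightarrow> tzeval (F k) t 0 = 0"
    and \<tau>0: "0 < \<tau>0" and R: "0 < R"
    and boundary: "k \<in> {1..k0} \<Longrightarrow> cmod t \<le> \<tau>0 \<Longrightarrow> 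
          newton_boundary (slice (F k) t) = newton_boundary (slice (F k) 0)"
    and nondeg: "S \<noteq> {} \<Longrightarrow> S \<subseteq> {1..k0} \<Longrightarrow> cmod t \<le> \<tau>0 \<Longrightarrow> nondeg_ci S (\<lambda>k. slice (F k) t)"
    and tame: "S \<noteq> {} \<Longrightarrow> S \<subseteq> {1..k0} \<Longrightarrow> cmod t \<le> \<tau>0 \<Longrightarrow> 
          \<exists>R'>R. tame_radius S (\<lambda>k. slice (F k) t) R'"
begin

section \<open>Supports and face limits, uniformly in the parameter\<close>

abbreviation f where "f k t \<equiv> zeval (slice (F k) t)"

lemma fin: "k \<in> {1..k0} \<Longrightarrow> finite (zsupp (slice (F k) t))"
  by (rule finite_zsupp_slice[OF poly])

text \<open>Were the support empty, all face functions of \<open>f k t\<close> would be zero, with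
  zero gradient, against non-degeneracy of the single factor \<open>k\<close> at the point with all
  coordinates 1.\<close>

lemma zsupp_ne:
  assumes k: "k \<in> {1..k0}" and t: "cmod t \<le> \<tau>0"
  shows "zsupp (slice (F k) t) \<noteq> {}"
proof
  assume "zsupp (slice (F k) t) = {}"
  then have 0: "zsupp (face_fun w (slice (F k) t)) = {}" for w using zsupp_face_fun by blast
  have z: "zeval (face_fun w (slice (F k) t)) = (\<lambda>_. 0)" for w
    by (rule ext) (simp only: zeval_def 0 sum.empty)
  have nd: "nondeg_ci {k} (\<lambda>k. slice (F k) t)" using nondeg[of "{k}"] k t by simp
  obtain w :: "'n \<Rightarrow> nat" where w: "\<And>i. w i > 0" by (rule that[of "\<lambda>_. 1"]) simp
  have "cindep_on {k} UNIV (\<lambda>k. cgrad (zeval (face_fun w (slice (F k) t))) (vec 1))"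
    by (rule nd[unfolded nondeg_ci_def, rule_format]) (auto simp: torus_def z w)
  then show False
    unfolding cindep_on_def by (auto simp: z cgrad_def cpartial_def dest: spec[of _ "\<lambda>_. 1"])
qed

text \<open>As \<open>t\<close> and \<open>t'\<close> may be exchanged, minimal
  \<open>w\<close>-degrees are constant on the parameter disc, also for weights with zero
  entries.\<close>

lemma wdeg_le:
  assumes "k \<in> {1..k0}" "cmod t \<le> \<tau>0" "cmod t' \<le> \<tau>0" "\<alpha> \<in> zsupp (slice (F k) t')"
  shows "\<exists>\<beta>\<in>zsupp (slice (F k) t). wdeg w \<beta> \<le> wdeg w \<alpha>"
  using assms boundary[of k t] boundary[of k t'] 
  by (intro newton_boundary_eq_imp_wdeg_le[where c' = "slice (F k) t'"] fin zsupp_ne) auto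

text \<open>For \<open>\<bar>t\<bar> \<le> \<tau>0\<close> this says that \<open>f\<^sup>k\<^sub>t\<close> does not vanish identically on \<open>\<complex>\<^sup>J\<close>.\<close>
definition live where "live J k \<longleftrightarrow> (\<exists>\<alpha>\<in>zsupp (slice (F k) 0). \<forall>i. i \<notin> J \<longrightarrow> \<alpha> i = 0)"

text \<open>For the indicator weight of the complement of \<open>J\<close>, an exponent lives in
  \<open>J\<close> exactly if its weight is 0, and minimal weights do not depend on the
  parameter.\<close>

lemma live_iff:
  assumes "k \<in> {1..k0}" "cmod t \<le> \<tau>0"
  shows "live J k \<longleftrightarrow> (\<exists>\<alpha>\<in>zsupp (slice (F k) t). \<forall>i. i \<notin> J \<longrightarrow> \<alpha> i = 0)"
proof -
  define w where "w i = (if i \<in> J then 0 else 1::nat)" for i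
  have w: "wdeg w \<alpha> = 0 \<longleftrightarrow> (\<forall>i. i \<notin> J \<longrightarrow> \<alpha> i = 0)" for \<alpha>
    by (auto simp: wdeg_eq_0_iff w_def)
  have "cmod 0 \<le> \<tau>0" using \<tau>0 by simp
  then show ?thesis
    unfolding live_def w[symmetric] using wdeg_le[of k _ _ _ w] assms by (metis le_zero_eq)
qed

lemma not_live_vanishes:
  assumes "k \<in> {1..k0}" "cmod t \<le> \<tau>0" "\<not> live J k"
  shows "vanishes_on_coord (f k t) J"
  using assms by (intro zeval_vanishes fin) (auto simp: live_iff[OF assms(1,2)])

text \<open>Each factor is divided by the scale of an exponent \<open>a k\<close> of minimal weight
  at \<open>t0\<close>. Heavier monomials tend to 0, those of equal weight converge to their values
  at \<open>u\<close>, and lighter ones do not occur for any \<open>t j\<close>.\<close>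

lemma face_limit:
  assumes t: "t \<longlonglongrightarrow> t0" "\<And>j. cmod (t j) \<le> \<tau>0" 
    and J: "\<And>j i. z j $ i \<noteq> 0 \<longleftrightarrow> i \<in> J" and z: "z \<longlonglongrightarrow> z0"
  obtains r w u N where "strict_mono (r :: nat \<Rightarrow> nat)" "\<And>i. w i = 0 \<longleftrightarrow> z0 $ i \<noteq> 0"
    "u \<in> torus" "\<And>i. z0 $ i \<noteq> 0 \<Longrightarrow> u $ i = z0 $ i" "\<And>k j. N k j > (0::real)"
    "\<And>k. k \<in> {1..k0} \<Longrightarrow> live J k \<Longrightarrow>
       (\<lambda>j. f k (t (r j)) (z (r j)) / of_real (N k j)) \<longlonglongrightarrow> zeval (face_fun w (slice (F k) t0)) u"
    "\<And>k i. k \<in> {1..k0} \<Longrightarrow> live J k \<Longrightarrow>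
       (\<lambda>j. z (r j) $ i * cgrad (f k (t (r j))) (z (r j)) $ i / of_real (N k j)) 
         \<longlonglongrightarrow> u $ i * cgrad (zeval (face_fun w (slice (F k) t0))) u $ i"
proof -
  define E where "E = (\<Union>k\<in>{1..k0}. tz_exps (F k))"
  have finE: "finite E" unfolding E_def using finite_tz_exps poly by blast
  have suppE: "zsupp (slice (F k) t) \<subseteq> E" if "k \<in> {1..k0}" for k t
    using zsupp_slice that unfolding E_def by blast
  have t0: "cmod t0 \<le> \<tau>0"
    by (rule LIMSEQ_le_const2[OF tendsto_norm[OF t(1)]]) (use t in auto)
  obtain r w u M where r: "strict_mono r" and w: "\<And>i. w i = 0 \<longleftrightarrow> z0 $ i \<noteq> 0" and
    u: "\<And>i. u $ i \<noteq> 0" "\<And>i. z0 $ i \<noteq> 0 \<Longrightarrow> u $ i = z0 $ i" and M: "\<And>j \<beta>. M j \<beta> > (0::real)" and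
    less: "\<And>\<alpha> \<beta>. \<alpha> \<in> E \<Longrightarrow> \<beta> \<in> E \<Longrightarrow> \<exists>i. i \<notin> J \<and> \<alpha> i > 0 \<Longrightarrow> \<forall>i. i \<notin> J \<longrightarrow> \<beta> i = 0 \<Longrightarrow>
       wdeg w \<beta> < wdeg w \<alpha>" and
    eq: "\<And>\<alpha> \<beta>. \<alpha> \<in> E \<Longrightarrow> \<beta> \<in> E \<Longrightarrow> \<forall>i. i \<notin> J \<longrightarrow> \<beta> i = 0 \<Longrightarrow> wdeg w \<alpha> = wdeg w \<beta> \<Longrightarrow>
       (\<lambda>j. zmonom (z (r j)) \<alpha> / of_real (M j \<beta>)) \<longlonglongrightarrow> zmonom u \<alpha>" and
    gr: "\<And>\<alpha> \<beta>. \<alpha> \<in> E \<Longrightarrow> \<beta> \<in> E \<Longrightarrow> \<forall>i. i \<notin> J \<longrightarrow> \<beta> i = 0 \<Longrightarrow> wdeg w \<beta> < wdeg w \<alpha> \<Longrightarrow>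
       (\<lambda>j. zmonom (z (r j)) \<alpha> / of_real (M j \<beta>)) \<longlonglongrightarrow> 0"
    by (rule toric_limit[OF finE J z]) (rule that)
  have "\<forall>k\<in>{1..k0}. \<exists>\<alpha>0. wdeg_min w (slice (F k) t0) \<alpha>0"
    using exists_min_wdeg[OF zsupp_ne[OF _ t0]] by metis
  then obtain a where a0: "\<And>k. k \<in> {1..k0} \<Longrightarrow> wdeg_min w (slice (F k) t0) (a k)" by metis
  note a = wdeg_minD[OF a0]
  \<comment> \<open>The multiplier \<open>\<phi>\<close> is 1 for the value of the factor and the
    exponent \<open>\<alpha> i\<close> for its logarithmic derivative.\<close>
  have main: "(\<lambda>j. (\<Sum>\<alpha>\<in>E. slice (F k) (t (r j)) \<alpha> * \<phi> \<alpha> * zmonom (z (r j)) \<alpha>) / of_real (M j (a k)))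
     \<longlonglongrightarrow> (\<Sum>\<alpha>\<in>E. face_fun w (slice (F k) t0) \<alpha> * \<phi> \<alpha> * zmonom u \<alpha>)"
    if k: "k \<in> {1..k0}" and lv: "live J k" for k \<phi>
    unfolding sum_divide_distrib
  proof (rule tendsto_sum)
    fix \<alpha> assume \<alpha>: "\<alpha> \<in> E"
    have aE: "a k \<in> E" using a(1)[OF k] suppE[OF k] by blast
    obtain \<beta> where \<beta>: "\<beta> \<in> zsupp (slice (F k) t0)" "\<forall>i. i \<notin> J \<longrightarrow> \<beta> i = 0"
      using lv live_iff[OF k t0] by blast
    \<comment> \<open>Otherwise the exponent \<open>\<beta>\<close>, which lives in
      \<open>J\<close>, would be strictly lighter than the minimal one.\<close>
    have aJ: "\<forall>i. i \<notin> J \<longrightarrow> a k i = 0"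
      using less[OF aE _ _ \<beta>(2)] \<beta>(1) a(2)[OF k \<beta>(1)] suppE[OF k] by (meson bot_nat_0.not_eq_extremum leD subsetD)
    have tr: "(\<lambda>j. t (r j)) \<longlonglongrightarrow> t0" using LIMSEQ_subseq_LIMSEQ[OF t(1) r] by (simp add: o_def)
    have face: "face_fun w (slice (F k) t0) \<alpha> = (if wdeg w \<alpha> = wdeg w (a k) then slice (F k) t0 \<alpha> else 0)"
      by (rule face_fun_eq[OF a0[OF k]])
    consider "wdeg w \<alpha> < wdeg w (a k)" | "wdeg w \<alpha> = wdeg w (a k)" | "wdeg w (a k) < wdeg w \<alpha>" by linarith
    then show "(\<lambda>j. slice (F k) (t (r j)) \<alpha> * \<phi> \<alpha> * zmonom (z (r j)) \<alpha> / of_real (M j (a k)))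
       \<longlonglongrightarrow> face_fun w (slice (F k) t0) \<alpha> * \<phi> \<alpha> * zmonom u \<alpha>"
    proof cases
      case 1
      \<comment> \<open>Being lighter than everything in the support at \<open>t0\<close>, this
        exponent is missing at all parameters, since minimal weights are constant. Convergence of
        its coefficient to 0 would not suffice, because the monomial may dominate the scale.\<close>
      have "slice (F k) (t (r j)) \<alpha> = 0" for j
        using wdeg_le[OF k t0 t(2)[of "r j"], of \<alpha> w] a(2)[OF k] 1 
        by (auto simp: zsupp_def) (meson leD order_trans)
      then show ?thesis using 1 by (simp add: face)
    next
      case 2
      have "(\<lambda>j. slice (F k) (t (r j)) \<alpha> * \<phi> \<alpha> * (zmonom (z (r j)) \<alpha> / of_real (M j (a k))))
         \<longlonglongrightarrow> slice (F k) t0 \<alpha> * \<phi> \<alpha> * zmonom u \<alpha>"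
        by (intro tendsto_intros tendsto_slice tr eq \<alpha> aE aJ 2)
      then show ?thesis using 2 by (simp add: face)
    next
      case 3
      have "(\<lambda>j. slice (F k) (t (r j)) \<alpha> * \<phi> \<alpha> * (zmonom (z (r j)) \<alpha> / of_real (M j (a k))))
         \<longlonglongrightarrow> slice (F k) t0 \<alpha> * \<phi> \<alpha> * 0"
        by (intro tendsto_intros tendsto_slice tr gr \<alpha> aE aJ 3)
      then show ?thesis using 3 by (simp add: face)
    qed
  qed
  show thesis
  proof
    show "strict_mono r" "\<And>i. w i = 0 \<longleftrightarrow> z0 $ i \<noteq> 0" "u \<in> torus" 
      "\<And>i. z0 $ i \<noteq> 0 \<Longrightarrow> u $ i = z0 $ i" "M j (a k) > 0" for j k
      using r w u M by (auto simp: torus_def)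
    fix k assume k: "k \<in> {1..k0}" "live J k"
    have s: "zsupp (face_fun w (slice (F k) t0)) \<subseteq> E" using zsupp_face_fun suppE[OF k(1)] by blast
    show "(\<lambda>j. f k (t (r j)) (z (r j)) / of_real (M j (a k))) \<longlonglongrightarrow> zeval (face_fun w (slice (F k) t0)) u"
      using main[OF k, of "\<lambda>_. 1"] by (simp add: zeval_eq_sum[OF finE suppE[OF k(1)]] zeval_eq_sum[OF finE s])
    show "(\<lambda>j. z (r j) $ i * cgrad (f k (t (r j))) (z (r j)) $ i / of_real (M j (a k))) 
         \<longlonglongrightarrow> u $ i * cgrad (zeval (face_fun w (slice (F k) t0))) u $ i" for i
      unfolding log_partial_eq_sum[OF finE suppE[OF k(1)]] log_partial_eq_sum[OF finE s]
      using main[OF k] .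
  qed
qed

lemma live_if_nonzero:
  assumes "k \<in> {1..k0}" "cmod t \<le> \<tau>0" "f k t z \<noteq> 0"
  shows "live {i. z $ i \<noteq> 0} k"
proof (rule ccontr)
  assume "\<not> live {i. z $ i \<noteq> 0} k"
  from not_live_vanishes[OF assms(1,2) this] show False
    using assms(3) by (simp add: vanishes_on_coord_def)
qed

lemma euler_sum:
  assumes "k \<in> {1..k0}" "cmod t \<le> \<tau>0"
  shows "(\<Sum>i\<in>UNIV. of_nat (w i) * (u $ i * cgrad (zeval (face_fun w (slice (F k) t))) u $ i))
     = of_real (newton_d w (slice (F k) t)) * zeval (face_fun w (slice (F k) t)) u"
  using assms by (intro euler_face_fun fin zsupp_ne)

section \<open>Limits of relations between logarithmic gradients\<close>

text \<open>The limit relation has right-hand side \<open>l 0 * p i\<close>, with \<open>p i\<close>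
  the limit of the squared modulus of \<open>z j $ i\<close> divided by the squared norm. Pairing
  with \<open>w\<close> annihilates the left-hand side by Euler's identity, since the face functions
  vanish at \<open>u\<close>. As \<open>z\<close> tends to 0, all weights are at least 1, so the
  weighted sum of \<open>p\<close> is at least 1 and \<open>l 0\<close> is zero. Non-degeneracy then
  excludes the remaining relation.\<close>

lemma stratum_transverse_sequence:
  assumes S: "S \<subseteq> {1..k0}" "\<And>k. k \<in> S \<Longrightarrow> live J k"
    and t: "t \<longlonglongrightarrow> 0" "\<And>j. cmod (t j) \<le> \<tau>0" 
    and J: "\<And>j i. z j $ i \<noteq> 0 \<longleftrightarrow> i \<in> J" "J \<noteq> {}" and z: "z \<longlonglongrightarrow> 0"
    and f0: "\<And>k j. k \<in> S \<Longrightarrow> f k (t j) (z j) = 0"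
    and eq: "\<And>j i. (\<Sum>k\<in>S. a k j * (z j $ i * cgrad (f k (t j)) (z j) $ i)) = m j * of_real ((cmod (z j $ i))\<^sup>2)"
    and nz: "\<And>j. (\<exists>k\<in>S. a k j \<noteq> 0) \<or> m j \<noteq> 0"
  shows False
proof -
  have \<tau>: "cmod 0 \<le> \<tau>0" using \<tau>0 by simp
  obtain r w u N where r: "strict_mono (r :: nat \<Rightarrow> nat)" and w: "\<And>i. w i = 0 \<longleftrightarrow> (0::complex^'n) $ i \<noteq> 0" and
    u: "u \<in> torus" "\<And>i. (0::complex^'n) $ i \<noteq> 0 \<Longrightarrow> u $ i = (0::complex^'n) $ i" and N: "\<And>k j. N k j > (0::real)" and
    fl: "\<And>k. k \<in> {1..k0} \<Longrightarrow> live J k \<Longrightarrow>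
       (\<lambda>j. f k (t (r j)) (z (r j)) / of_real (N k j)) \<longlonglongrightarrow> zeval (face_fun w (slice (F k) 0)) u" and
    vl: "\<And>k i. k \<in> {1..k0} \<Longrightarrow> live J k \<Longrightarrow>
       (\<lambda>j. z (r j) $ i * cgrad (f k (t (r j))) (z (r j)) $ i / of_real (N k j)) 
         \<longlonglongrightarrow> u $ i * cgrad (zeval (face_fun w (slice (F k) 0))) u $ i"
    by (rule face_limit[OF t J(1) z]) (rule that)
  have wpos: "w i > 0" for i using w[of i] by (simp add: neq0_conv[symmetric] del: neq0_conv)
  define g where "g k = zeval (face_fun w (slice (F k) 0))" for k
  have g0: "g k u = 0" if "k \<in> S" for k
    using fl[of k] S that by (auto simp: f0 g_def LIMSEQ_const_iff)
  define Q where "Q j = (\<Sum>i\<in>UNIV. (cmod (z j $ i))\<^sup>2)" for j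
  have Q: "Q j > 0" for j
  proof -
    obtain i where "z j $ i \<noteq> 0" using J by blast
    then show ?thesis unfolding Q_def by (intro sum_pos2[of _ i]) auto
  qed
  have finS: "finite S" using S finite_subset by blast
  have S0: "0 \<notin> S" using S by auto
  \<comment> \<open>The index 0 is free because \<open>S\<close> consists of positive indices; it
    carries the radial coefficient times the squared norm \<open>Q\<close>. The other coefficients
    absorb the scales \<open>N\<close>, so all are normalised together.\<close>
  define c where "c k j = (if k = 0 then m (r j) * of_real (Q (r j)) else a k (r j) * of_real (N k j))" for k :: nat and j
  have c0: "c 0 j = m (r j) * of_real (Q (r j))" for j by (simp add: c_def)
  have cS: "c k j = a k (r j) * of_real (N k j)" if "k \<in> S" for k j using that S0 by (auto simp: c_def)
  have cpos: "(\<Sum>k\<in>insert 0 S. cmod (c k j)) > 0" for j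
  proof -
    have Nn: "N k j \<noteq> 0" for k using N[of k j] by simp
    obtain k where "k \<in> insert 0 S" "c k j \<noteq> 0"
      using nz[of "r j"] Q[of "r j"] Nn c0 cS by (metis insertCI less_numeral_extra(3) no_zero_divisors of_real_eq_0_iff)
    then show ?thesis by (intro sum_pos2[of _ k]) (use finS in auto)
  qed
  obtain r2 l where r2: "strict_mono (r2 :: nat \<Rightarrow> nat)" and l: "\<exists>k\<in>insert 0 S. l k \<noteq> 0" 
    "\<And>k. k \<in> insert 0 S \<Longrightarrow> (\<lambda>j. c k (r2 j) / of_real (\<Sum>k\<in>insert 0 S. cmod (c k (r2 j)))) \<longlonglongrightarrow> l k"
    by (rule normalized_subsequence[OF finite.insertI[OF finS] cpos]) (rule that)
  define q where "q i j = complex_of_real ((cmod (z (r (r2 j)) $ i))\<^sup>2 / Q (r (r2 j)))" for i j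
  have qb: "bounded (range (q i))" for i
  proof -
    have "(cmod (z j $ i))\<^sup>2 \<le> Q j" for j unfolding Q_def by (rule member_le_sum) auto
    then have "cmod (q i j) \<le> 1" for j using Q[of "r (r2 j)"] unfolding q_def norm_of_real by simp
    then show ?thesis by (auto simp: bounded_iff)
  qed
  obtain r3 p where r3: "strict_mono r3" and p: "\<And>i. (\<lambda>j. q i (r3 j)) \<longlonglongrightarrow> p i"
    using common_bounded_limits[of UNIV q] qb by auto
  have V: "(\<Sum>k\<in>S. l k * (u $ i * cgrad (g k) u $ i)) = l 0 * p i" for i
  proof -
    define s where "s j = (\<Sum>k\<in>insert 0 S. cmod (c k (r2 (r3 j))))" for j
    have ll: "(\<lambda>j. c k (r2 (r3 j)) / of_real (s j)) \<longlonglongrightarrow> l k" if "k \<in> insert 0 S" for k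
      using LIMSEQ_subseq_LIMSEQ[OF l(2)[OF that] r3] by (simp add: o_def s_def)
    have vv: "(\<lambda>j. z (r (r2 (r3 j))) $ i * cgrad (f k (t (r (r2 (r3 j))))) (z (r (r2 (r3 j)))) $ i / of_real (N k (r2 (r3 j)))) 
         \<longlonglongrightarrow> u $ i * cgrad (g k) u $ i" if "k \<in> S" for k
      using LIMSEQ_subseq_LIMSEQ[OF LIMSEQ_subseq_LIMSEQ[OF vl r2] r3, of k i] S that unfolding o_def g_def by blast
    have "(\<lambda>j. \<Sum>k\<in>S. (c k (r2 (r3 j)) / of_real (s j)) * (z (r (r2 (r3 j))) $ i * cgrad (f k (t (r (r2 (r3 j))))) (z (r (r2 (r3 j)))) $ i / of_real (N k (r2 (r3 j)))))
        \<longlonglongrightarrow> (\<Sum>k\<in>S. l k * (u $ i * cgrad (g k) u $ i))"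
      by (intro tendsto_intros ll vv) auto
    moreover have "(\<Sum>k\<in>S. (c k (r2 (r3 j)) / of_real (s j)) * (z (r (r2 (r3 j))) $ i * cgrad (f k (t (r (r2 (r3 j))))) (z (r (r2 (r3 j)))) $ i / of_real (N k (r2 (r3 j)))))
       = (c 0 (r2 (r3 j)) / of_real (s j)) * q i (r3 j)" for j
    proof -
      let ?j = "r2 (r3 j)"
      have Nn: "N k ?j \<noteq> 0" for k using N[of k ?j] by simp
      have "(\<Sum>k\<in>S. (c k ?j / of_real (s j)) * (z (r ?j) $ i * cgrad (f k (t (r ?j))) (z (r ?j)) $ i / of_real (N k ?j)))
         = (\<Sum>k\<in>S. a k (r ?j) * (z (r ?j) $ i * cgrad (f k (t (r ?j))) (z (r ?j)) $ i)) / of_real (s j)"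
        unfolding sum_divide_distrib by (intro sum.cong refl) (simp add: cS Nn)
      also have "\<dots> = m (r ?j) * of_real ((cmod (z (r ?j) $ i))\<^sup>2) / of_real (s j)" unfolding eq ..
      also have "\<dots> = (c 0 ?j / of_real (s j)) * q i (r3 j)"
        using Q[of "r ?j"] by (simp add: c0 q_def)
      finally show ?thesis .
    qed
    ultimately have "(\<lambda>j. (c 0 (r2 (r3 j)) / of_real (s j)) * q i (r3 j)) \<longlonglongrightarrow> (\<Sum>k\<in>S. l k * (u $ i * cgrad (g k) u $ i))"
      by simp
    moreover have "(\<lambda>j. (c 0 (r2 (r3 j)) / of_real (s j)) * q i (r3 j)) \<longlonglongrightarrow> l 0 * p i"
      by (intro tendsto_intros ll p) auto
    ultimately show ?thesis by (rule LIMSEQ_unique)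
  qed
  have "(\<Sum>i\<in>UNIV. of_nat (w i) * (l 0 * p i)) = (\<Sum>i\<in>UNIV. of_nat (w i) * (\<Sum>k\<in>S. l k * (u $ i * cgrad (g k) u $ i)))"
    unfolding V ..
  also have "\<dots> = (\<Sum>k\<in>S. l k * (\<Sum>i\<in>UNIV. of_nat (w i) * (u $ i * cgrad (g k) u $ i)))"
    unfolding sum_distrib_left by (subst sum.swap) (simp add: mult_ac)
  also have "\<dots> = 0"
    using S(1) by (intro sum.neutral ballI) (auto simp: g_def euler_sum[OF _ \<tau>] g0[unfolded g_def])
  finally have E: "l 0 * (\<Sum>i\<in>UNIV. of_nat (w i) * p i) = 0" by (simp add: sum_distrib_left mult_ac)
  have "(\<lambda>j. \<Sum>i\<in>UNIV. Re (of_nat (w i) * q i (r3 j))) \<longlonglongrightarrow> (\<Sum>i\<in>UNIV. Re (of_nat (w i) * p i))"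
    by (intro tendsto_intros p)
  moreover have "(\<Sum>i\<in>UNIV. Re (of_nat (w i) * q i (r3 j))) \<ge> 1" for j
  proof -
    let ?j = "r (r2 (r3 j))"
    have "1 = (\<Sum>i\<in>UNIV. (cmod (z ?j $ i))\<^sup>2 / Q ?j)"
      using Q[of ?j] by (simp add: sum_divide_distrib[symmetric] Q_def[symmetric])
    also have "\<dots> \<le> (\<Sum>i\<in>UNIV. real (w i) * ((cmod (z ?j $ i))\<^sup>2 / Q ?j))"
    proof (rule sum_mono)
      fix i
      have "(cmod (z ?j $ i))\<^sup>2 / Q ?j \<ge> 0" using Q[of ?j] by simp
      from mult_right_mono[OF _ this, of 1 "real (w i)"] wpos[of i]
      show "(cmod (z ?j $ i))\<^sup>2 / Q ?j \<le> real (w i) * ((cmod (z ?j $ i))\<^sup>2 / Q ?j)" by simp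
    qed
    finally show ?thesis by (simp add: q_def)
  qed
  ultimately have "(\<Sum>i\<in>UNIV. Re (of_nat (w i) * p i)) \<ge> 1"
    by (intro LIMSEQ_le_const) auto
  then have "Re (\<Sum>i\<in>UNIV. of_nat (w i) * p i) \<ge> 1" by simp
  then have "(\<Sum>i\<in>UNIV. of_nat (w i) * p i) \<noteq> 0" by (metis not_one_le_zero zero_complex.sel(1))
  with E have l0: "l 0 = 0" by simp
  then obtain k where k: "k \<in> S" "l k \<noteq> 0" using l(1) by auto
  have "cindep_on S UNIV (\<lambda>k. cgrad (g k) u)"
    unfolding g_def by (rule nondeg[OF _ S(1) \<tau>, unfolded nondeg_ci_def, rule_format])
       (use k wpos u g0 in \<open>auto simp: g_def\<close>)
  moreover have "(\<Sum>k\<in>S. l k * cgrad (g k) u $ i) = 0" for i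
  proof -
    have "u $ i * (\<Sum>k\<in>S. l k * cgrad (g k) u $ i) = 0"
      using V[of i] l0 by (simp add: sum_distrib_left mult_ac)
    then show ?thesis using u(1) by (simp add: torus_def)
  qed
  ultimately show False using k unfolding cindep_on_def by blast
qed

text \<open>The bounded alternative contradicts the vanishing of the product in the limit; the
  unbounded one gives the nontrivial relation. The clause on \<open>\<mu>\<close> is for smoothness,
  where the radial term is absent and a nonzero \<open>l k\<close> must exist.\<close>

lemma log_gradient_limit:
  assumes t: "t \<longlonglongrightarrow> t0" "\<And>j. cmod (t j) \<le> \<tau>0" 
    and J: "\<And>j i. z j $ i \<noteq> 0 \<longleftrightarrow> i \<in> J" and z: "z \<longlonglongrightarrow> z0"
    and fn: "\<And>k j. k \<in> {1..k0} \<Longrightarrow> f k (t j) (z j) \<noteq> 0"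
    and eq: "\<And>j i. (\<Sum>k\<in>{1..k0}. z j $ i * cgrad (f k (t j)) (z j) $ i / f k (t j) (z j))
         = \<mu> j * of_real ((cmod (z j $ i))\<^sup>2)"
    and f0: "(\<lambda>j. \<Prod>k\<in>{1..k0}. f k (t j) (z j)) \<longlonglongrightarrow> 0"
  obtains w u l m where "\<And>i. w i = 0 \<longleftrightarrow> z0 $ i \<noteq> 0" "u \<in> torus" "\<And>i. z0 $ i \<noteq> 0 \<Longrightarrow> u $ i = z0 $ i"
    "(\<exists>k\<in>{1..k0}. l k \<noteq> 0) \<or> m \<noteq> 0" "(\<forall>j. \<mu> j = 0) \<Longrightarrow> m = 0"
    "\<And>k. k \<in> {1..k0} \<Longrightarrow> zeval (face_fun w (slice (F k) t0)) u \<noteq> 0 \<Longrightarrow> l k = 0"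
    "\<And>i. (\<Sum>k\<in>{1..k0}. l k * (u $ i * cgrad (zeval (face_fun w (slice (F k) t0))) u $ i))
        = m * of_real ((cmod (z0 $ i))\<^sup>2)"
proof -
  have t0: "cmod t0 \<le> \<tau>0"
    by (rule LIMSEQ_le_const2[OF tendsto_norm[OF t(1)]]) (use t in auto)
  obtain r w u N where r: "strict_mono (r :: nat \<Rightarrow> nat)" and w: "\<And>i. w i = 0 \<longleftrightarrow> z0 $ i \<noteq> 0" and
    u: "u \<in> torus" "\<And>i. z0 $ i \<noteq> 0 \<Longrightarrow> u $ i = z0 $ i" and N: "\<And>k j. N k j > (0::real)" and
    fl: "\<And>k. k \<in> {1..k0} \<Longrightarrow> live J k \<Longrightarrow>
       (\<lambda>j. f k (t (r j)) (z (r j)) / of_real (N k j)) \<longlonglongrightarrow> zeval (face_fun w (slice (F k) t0)) u" and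
    vl: "\<And>k i. k \<in> {1..k0} \<Longrightarrow> live J k \<Longrightarrow>
       (\<lambda>j. z (r j) $ i * cgrad (f k (t (r j))) (z (r j)) $ i / of_real (N k j)) 
         \<longlonglongrightarrow> u $ i * cgrad (zeval (face_fun w (slice (F k) t0))) u $ i"
    by (rule face_limit[OF t J z]) (rule that)
  have live: "live J k" if "k \<in> {1..k0}" for k
    using live_if_nonzero[OF that t(2) fn[OF that], of 0] J by simp
  define g where "g k = zeval (face_fun w (slice (F k) t0))" for k
  have fg: "(\<lambda>j. f k (t (r j)) (z (r j)) / of_real (N k j)) \<longlonglongrightarrow> g k u" if "k \<in> {1..k0}" for k
    using fl[OF that live[OF that]] by (simp add: g_def)
  \<comment> \<open>With minus \<open>\<mu>\<close> at the free index 0, the assumed equation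
    becomes the homogeneous relation \<open>cy\<close>, and the radial coefficient is treated like
    the others.\<close>
  define c where "c k j = (if k = 0 then - \<mu> (r j) else of_real (N k j) / f k (t (r j)) (z (r j)))" for k :: nat and j
  define y where "y k i j = (if k = 0 then of_real ((cmod (z (r j) $ i))\<^sup>2)
      else z (r j) $ i * cgrad (f k (t (r j))) (z (r j)) $ i / of_real (N k j))" for k :: nat and i j
  define Y where "Y k i = (if k = 0 then of_real ((cmod (z0 $ i))\<^sup>2) else u $ i * cgrad (g k) u $ i)" for k :: nat and i
  have split: "(\<Sum>k\<in>{0..k0}. h k) = h 0 + (\<Sum>k\<in>{1..k0}. h k)" for h :: "nat \<Rightarrow> complex"
    by (simp add: sum.atLeast_Suc_atMost)
  have zr: "(\<lambda>j. z (r j)) \<longlonglongrightarrow> z0" using LIMSEQ_subseq_LIMSEQ[OF z r] by (simp add: o_def)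
  have yl: "y k i \<longlonglongrightarrow> Y k i" if "k \<in> {0..k0}" for k i
  proof (cases "k = 0")
    case True
    have "(\<lambda>j. complex_of_real ((cmod (z (r j) $ i))\<^sup>2)) \<longlonglongrightarrow> of_real ((cmod (z0 $ i))\<^sup>2)"
      by (intro tendsto_intros zr)
    then show ?thesis using True by (simp add: y_def[abs_def] Y_def)
  next
    case False
    then show ?thesis using vl[OF _ live] that by (simp add: y_def[abs_def] Y_def g_def)
  qed
  have Nn: "N k j \<noteq> 0" for k j using N[of k j] by simp
  have cy: "(\<Sum>k\<in>{0..k0}. c k j * y k i j) = 0" for i j
  proof -
    have "(\<Sum>k\<in>{1..k0}. c k j * y k i j) = (\<Sum>k\<in>{1..k0}. z (r j) $ i * cgrad (f k (t (r j))) (z (r j)) $ i / f k (t (r j)) (z (r j)))"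
      by (intro sum.cong refl) (simp add: c_def y_def Nn)
    then show ?thesis unfolding split eq by (simp add: c_def y_def)
  qed
  have fc: "f k (t (r j)) (z (r j)) / of_real (N k j) * c k j = 1" if "k \<in> {1..k0}" for k j
    using that fn[OF that, of "r j"] Nn[of k j] by (simp add: c_def)
  from finite_atLeastAtMost[of 0 k0] show thesis
  proof (cases rule: bounded_or_normalized_subsequence[of "{0..k0}" c])
    case (unbounded s l \<Lambda>)
    have "(\<Sum>k\<in>{0..k0}. l k * Y k i) = 0" for i
    proof -
      have "(\<lambda>j. \<Sum>k\<in>{0..k0}. (c k (s j) / of_real (\<Lambda> j)) * y k i (s j)) \<longlonglongrightarrow> (\<Sum>k\<in>{0..k0}. l k * Y k i)"
        by (intro tendsto_intros unbounded(3) LIMSEQ_subseq_LIMSEQ[OF yl unbounded(1), unfolded o_def]) auto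
      moreover have "(\<Sum>k\<in>{0..k0}. (c k (s j) / of_real (\<Lambda> j)) * y k i (s j)) = 0" for j
        using cy[of "s j" i] by (simp add: sum_divide_distrib[symmetric])
      ultimately show ?thesis by (simp add: LIMSEQ_const_iff)
    qed
    then have sum0: "(\<Sum>k\<in>{1..k0}. l k * (u $ i * cgrad (g k) u $ i)) = - l 0 * of_real ((cmod (z0 $ i))\<^sup>2)" for i
      unfolding split by (simp add: Y_def add_eq_0_iff)
    \<comment> \<open>If the face function does not vanish at \<open>u\<close>, the coefficient
      \<open>c k\<close> converges, so dividing it by \<open>\<Lambda>\<close> sends it to
      0.\<close>
    have lz: "l k = 0" if k: "k \<in> {1..k0}" "g k u \<noteq> 0" for k
    proof -
      have "(\<lambda>j. 1 / (f k (t (r (s j))) (z (r (s j))) / of_real (N k (s j)))) \<longlonglongrightarrow> 1 / g k u"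
        using LIMSEQ_subseq_LIMSEQ[OF fg[OF k(1)] unbounded(1)] k(2) unfolding o_def by (intro tendsto_divide) auto
      moreover have "1 / (f k (t (r (s j))) (z (r (s j))) / of_real (N k (s j))) = c k (s j)" for j
        using k(1) by (simp add: c_def)
      ultimately have "(\<lambda>j. c k (s j)) \<longlonglongrightarrow> 1 / g k u" by simp
      moreover have "(\<lambda>j. complex_of_real (inverse (\<Lambda> j))) \<longlonglongrightarrow> of_real 0"
        by (intro tendsto_of_real tendsto_inverse_0_at_top unbounded(2))
      ultimately have "(\<lambda>j. c k (s j) * of_real (inverse (\<Lambda> j))) \<longlonglongrightarrow> 1 / g k u * of_real 0"
        by (rule tendsto_mult)
      then have "(\<lambda>j. c k (s j) / of_real (\<Lambda> j)) \<longlonglongrightarrow> 0" by (simp add: divide_inverse)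
      then show ?thesis using unbounded(3)[of k] k(1) LIMSEQ_unique by auto
    qed
    show thesis
    proof (rule that[of w u l "- l 0"])
      show "(\<exists>k\<in>{1..k0}. l k \<noteq> 0) \<or> - l 0 \<noteq> 0"
        using unbounded(4) by (metis atLeastAtMost_iff less_one neg_equal_0_iff_equal not_le)
      show "- l 0 = 0" if "\<forall>j. \<mu> j = 0"
        using unbounded(3)[of 0] that by (simp add: c_def LIMSEQ_const_iff)
    qed (use w u lz sum0 in \<open>auto simp: g_def\<close>)
  next
    case (bounded s l)
    have gl: "g k u * l k = 1" if "k \<in> {1..k0}" for k
    proof -
      have "(\<lambda>j. f k (t (r (s j))) (z (r (s j))) / of_real (N k (s j)) * c k (s j)) \<longlonglongrightarrow> g k u * l k"
        using LIMSEQ_subseq_LIMSEQ[OF fg[OF that] bounded(1)] bounded(2)[of k] that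
        unfolding o_def by (intro tendsto_mult) auto
      then show ?thesis unfolding fc[OF that] by (simp add: LIMSEQ_const_iff)
    qed
    have Y0: "(\<Sum>k\<in>{0..k0}. l k * Y k i) = 0" for i
    proof -
      have "(\<lambda>j. \<Sum>k\<in>{0..k0}. c k (s j) * y k i (s j)) \<longlonglongrightarrow> (\<Sum>k\<in>{0..k0}. l k * Y k i)"
        by (intro tendsto_intros bounded(2) LIMSEQ_subseq_LIMSEQ[OF yl bounded(1), unfolded o_def]) auto
      then show ?thesis unfolding cy by (simp add: LIMSEQ_const_iff)
    qed
    let ?d = "\<lambda>k. newton_d w (slice (F k) t0)"
    have d0: "?d k \<ge> 0" if k: "k \<in> {1..k0}" for k
    proof -
      obtain \<alpha>0 where "wdeg_min w (slice (F k) t0) \<alpha>0" using exists_min_wdeg[OF zsupp_ne[OF k t0]] by blast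
      then show ?thesis by (simp add: newton_d_eq_Min)
    qed
    \<comment> \<open>Here \<open>l k\<close> is the inverse of \<open>g k u\<close>, so pairing the
      relation with \<open>w\<close> gives the sum of the degrees. The radial side gives 0, since
      \<open>w\<close> vanishes where \<open>z0\<close> does not. The degrees are nonnegative, so
      all are 0; then each \<open>g k u\<close> is the value of \<open>f k t0\<close> at
      \<open>z0\<close>, and none of these values is zero.\<close>
    have "of_real (\<Sum>k\<in>{1..k0}. ?d k) = (\<Sum>k\<in>{1..k0}. of_real (?d k) * (g k u * l k))"
      by (simp add: gl)
    also have "\<dots> = (\<Sum>k\<in>{1..k0}. l k * (\<Sum>i\<in>UNIV. of_nat (w i) * (u $ i * cgrad (g k) u $ i)))"
      by (intro sum.cong refl) (simp add: g_def euler_sum[OF _ t0])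
    also have "\<dots> = (\<Sum>i\<in>UNIV. of_nat (w i) * (\<Sum>k\<in>{1..k0}. l k * Y k i))"
      unfolding sum_distrib_left by (subst sum.swap) (simp add: mult_ac Y_def)
    also have "\<dots> = 0"
    proof (intro sum.neutral ballI)
      fix i :: 'n
      have "z0 $ i = 0" if "w i \<noteq> 0" using w[of i] that by simp
      moreover have "(\<Sum>k\<in>{1..k0}. l k * Y k i) = - l 0 * of_real ((cmod (z0 $ i))\<^sup>2)"
        using Y0[of i] unfolding split by (simp add: Y_def add_eq_0_iff)
      ultimately show "of_nat (w i) * (\<Sum>k\<in>{1..k0}. l k * Y k i) = 0" by auto
    qed
    finally have "(\<Sum>k\<in>{1..k0}. ?d k) = 0" by (simp only: of_real_eq_0_iff)
    then have dz: "?d k = 0" if "k \<in> {1..k0}" for k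
      using d0 that by (subst (asm) sum_nonneg_eq_0_iff) auto
    have "f k t0 z0 \<noteq> 0" if k: "k \<in> {1..k0}" for k
    proof -
      obtain \<alpha>0 where "wdeg_min w (slice (F k) t0) \<alpha>0" using exists_min_wdeg[OF zsupp_ne[OF k t0]] by blast
      then have "\<alpha>0 \<in> zsupp (slice (F k) t0)" "wdeg w \<alpha>0 = 0"
        using dz[OF k] by (simp_all add: newton_d_eq_Min wdeg_minD(1))
      then have "g k u = f k t0 z0"
        unfolding g_def
      proof (rule face_fun_weight_zero(1)[OF fin[OF k]])
        show "u $ i = z0 $ i" if "w i = 0" for i using u(2) w[of i] that by simp
        show "z0 $ i = 0" if "w i > 0" for i using w[of i] that by simp
      qed
      then show ?thesis using gl[OF k] by auto
    qed
    moreover have "(\<lambda>j. \<Prod>k\<in>{1..k0}. f k (t j) (z j)) \<longlonglongrightarrow> (\<Prod>k\<in>{1..k0}. f k t0 z0)"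
      by (intro tendsto_prod tendsto_zeval_slice poly t z)
    then have "(\<Prod>k\<in>{1..k0}. f k t0 z0) = 0" using f0 LIMSEQ_unique by blast
    ultimately show thesis by auto
  qed
qed

section \<open>Uniform transversality and smoothness near the origin\<close>

lemma stratum_transverse:
  "\<exists>\<rho>>0. \<forall>(J, S)\<in>UNIV \<times> Pow {1..k0}. \<forall>t z a m. cmod t \<le> \<rho> \<longrightarrow> norm z \<le> \<rho> \<longrightarrow> cmod t \<le> \<tau>0 \<longrightarrow> J \<noteq> {} \<longrightarrow>
     (\<forall>i. z $ i \<noteq> 0 \<longleftrightarrow> i \<in> J) \<longrightarrow> (\<forall>k\<in>S. live J k \<and> f k t z = 0) \<longrightarrow>
     (\<forall>i. (\<Sum>k\<in>S. a k * (z $ i * cgrad (f k t) z $ i)) = m * of_real ((cmod (z $ i))\<^sup>2)) \<longrightarrow>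
     (\<forall>k\<in>S. a k = 0) \<and> m = 0" (is "\<exists>\<rho>>0. \<forall>(J, S)\<in>?X. ?P J S \<rho>")
proof (rule finite_uniform_radius)
  show "finite ?X" by simp
  fix x :: "'n set \<times> nat set" assume x: "x \<in> ?X"
  obtain J S where JS: "x = (J, S)" by (cases x)
  have "\<exists>\<rho>>0. ?P J S \<rho>"
  proof (rule ccontr)
    assume neg: "\<not> ?thesis"
    have nP: "\<not> ?P J S (1 / real (Suc n))" for n
    proof (rule notI, rule notE[OF neg], rule exI, rule conjI)
      show "1 / real (Suc n) > 0" by simp
    qed
    define Q where "Q n t z a m \<longleftrightarrow> cmod t \<le> 1 / real (Suc n) \<and> norm z \<le> 1 / real (Suc n) \<and> cmod t \<le> \<tau>0 \<and> J \<noteq> {} \<and>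
     (\<forall>i. z $ i \<noteq> 0 \<longleftrightarrow> i \<in> J) \<and> (\<forall>k\<in>S. live J k \<and> f k t z = 0) \<and>
     (\<forall>i. (\<Sum>k\<in>S. a k * (z $ i * cgrad (f k t) z $ i)) = m * of_real ((cmod (z $ i))\<^sup>2)) \<and>
     ((\<exists>k\<in>S. a k \<noteq> 0) \<or> m \<noteq> 0)" for n :: nat and t z a m
    have "\<exists>t z a m. Q n t z a m" for n
      using nP[of n] unfolding Q_def by (auto simp del: of_nat_Suc)
    then obtain t z a m where "\<And>n. Q n (t n) (z n) (a n) (m n)" by metis
    then have H: "\<And>n. cmod (t n) \<le> 1 / real (Suc n)" "\<And>n. norm (z n) \<le> 1 / real (Suc n)"
      "\<And>n. cmod (t n) \<le> \<tau>0" "J \<noteq> {}" "\<And>n i. z n $ i \<noteq> 0 \<longleftrightarrow> i \<in> J"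
      "\<And>n k. k \<in> S \<Longrightarrow> live J k \<and> f k (t n) (z n) = 0"
      "\<And>n i. (\<Sum>k\<in>S. a n k * (z n $ i * cgrad (f k (t n)) (z n) $ i)) = m n * of_real ((cmod (z n $ i))\<^sup>2)"
      "\<And>n. (\<exists>k\<in>S. a n k \<noteq> 0) \<or> m n \<noteq> 0"
      unfolding Q_def by blast+
    show False
      by (rule stratum_transverse_sequence[of S J t z "\<lambda>k n. a n k" m])
        (use x JS H small_sequence[OF H(1)] small_sequence[OF H(2)] in auto)
  qed
  then show "\<exists>\<rho>>0. case x of (J, S) \<Rightarrow> ?P J S \<rho>" by (simp add: JS)
next
  fix x :: "'n set \<times> nat set" and \<rho> \<rho>' :: real
  obtain J S where JS: "x = (J, S)" by (cases x)
  assume "case x of (J, S) \<Rightarrow> ?P J S \<rho>" and le: "\<rho>' \<le> \<rho>"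
  then have A: "?P J S \<rho>" by (simp only: JS prod.case)
  have "?P J S \<rho>'"
  proof (rule allI, rule allI, rule allI, rule allI, rule impI, rule impI)
    fix t and z :: "complex ^ 'n" and a m assume "cmod t \<le> \<rho>'" "norm z \<le> \<rho>'"
    then have "cmod t \<le> \<rho>" "norm z \<le> \<rho>" using le by linarith+
    from A[THEN spec, THEN spec, THEN spec, THEN spec, THEN mp, OF this(1), THEN mp, OF this(2)]
    show "cmod t \<le> \<tau>0 \<longrightarrow> J \<noteq> {} \<longrightarrow>
     (\<forall>i. z $ i \<noteq> 0 \<longleftrightarrow> i \<in> J) \<longrightarrow> (\<forall>k\<in>S. live J k \<and> f k t z = 0) \<longrightarrow>
     (\<forall>i. (\<Sum>k\<in>S. a k * (z $ i * cgrad (f k t) z $ i)) = m * of_real ((cmod (z $ i))\<^sup>2)) \<longrightarrow>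
     (\<forall>k\<in>S. a k = 0) \<and> m = 0" .
  qed
  then show "case x of (J, S) \<Rightarrow> ?P J S \<rho>'" by (simp only: JS prod.case)
qed

text \<open>A sequence of critical points tending to the origin has a positive limit weight. The
  limit relation then contradicts non-degeneracy for the factors with nonzero coefficient, whose
  face functions all vanish at \<open>u\<close>.\<close>

lemma smooth_near_origin:
  assumes k0: "k0 \<ge> 1"
  shows "\<exists>\<rho>>0. \<forall>J\<in>UNIV. \<forall>t z. cmod t \<le> \<rho> \<longrightarrow> norm z \<le> \<rho> \<longrightarrow> cmod t \<le> \<tau>0 \<longrightarrow>
     (\<forall>i. z $ i \<noteq> 0 \<longleftrightarrow> i \<in> J) \<longrightarrow> (\<forall>k\<in>{1..k0}. f k t z \<noteq> 0) \<longrightarrow>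
     (\<exists>i. (\<Sum>k\<in>{1..k0}. z $ i * cgrad (f k t) z $ i / f k t z) \<noteq> 0)" (is "\<exists>\<rho>>0. \<forall>J\<in>UNIV. ?P J \<rho>")
proof (rule finite_uniform_radius)
  fix J :: "'n set"
  show "\<exists>\<rho>>0. ?P J \<rho>"
  proof (rule ccontr)
    assume neg: "\<not> ?thesis"
    have nP: "\<not> ?P J (1 / real (Suc n))" for n
    proof (rule notI, rule notE[OF neg], rule exI, rule conjI)
      show "1 / real (Suc n) > 0" by simp
    qed
    define Q where "Q n t z \<longleftrightarrow> cmod t \<le> 1 / real (Suc n) \<and> norm z \<le> 1 / real (Suc n) \<and> cmod t \<le> \<tau>0 \<and>
     (\<forall>i. z $ i \<noteq> 0 \<longleftrightarrow> i \<in> J) \<and> (\<forall>k\<in>{1..k0}. f k t z \<noteq> 0) \<and>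
     (\<forall>i. (\<Sum>k\<in>{1..k0}. z $ i * cgrad (f k t) z $ i / f k t z) = 0)" for n :: nat and t z
    have "\<exists>t z. Q n t z" for n
      using nP[of n] unfolding Q_def by (auto simp del: of_nat_Suc)
    then obtain t z where "\<And>n. Q n (t n) (z n)" by metis
    then have H: "\<And>n. cmod (t n) \<le> 1 / real (Suc n)" "\<And>n. norm (z n) \<le> 1 / real (Suc n)"
      "\<And>n. cmod (t n) \<le> \<tau>0" "\<And>n i. z n $ i \<noteq> 0 \<longleftrightarrow> i \<in> J"
      "\<And>n k. k \<in> {1..k0} \<Longrightarrow> f k (t n) (z n) \<noteq> 0"
      "\<And>n i. (\<Sum>k\<in>{1..k0}. z n $ i * cgrad (f k (t n)) (z n) $ i / f k (t n) (z n)) = 0"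
      unfolding Q_def by blast+
    have t: "t \<longlonglongrightarrow> 0" and z: "z \<longlonglongrightarrow> 0" using small_sequence[OF H(1)] small_sequence[OF H(2)] .
    have "(\<lambda>j. \<Prod>k\<in>{1..k0}. f k (t j) (z j)) \<longlonglongrightarrow> (\<Prod>k\<in>{1..k0}. f k 0 0)"
      by (intro tendsto_prod tendsto_zeval_slice poly t z)
    moreover have "(\<Prod>k\<in>{1..k0}. f k 0 0) = 0"
      using k0 vanish_0[of 1 0] by (intro prod_zero) (auto simp: tzeval_eq_zeval_slice[OF poly] intro!: bexI[of _ 1])
    ultimately have f0: "(\<lambda>j. \<Prod>k\<in>{1..k0}. f k (t j) (z j)) \<longlonglongrightarrow> 0" by (simp only:)
    \<comment> \<open>Written with a zero radial coefficient, so that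
      \<open>log_gradient_limit\<close> returns \<open>m = 0\<close> and hence some nonzero
      \<open>l k\<close>.\<close>
    have eq: "(\<Sum>k\<in>{1..k0}. z j $ i * cgrad (f k (t j)) (z j) $ i / f k (t j) (z j))
         = 0 * of_real ((cmod (z j $ i))\<^sup>2)" for i j by (simp only: H(6) mult_zero_left)
    obtain w u l m where w: "\<And>i. w i = 0 \<longleftrightarrow> (0::complex^'n) $ i \<noteq> 0" and u: "u \<in> torus" 
      "\<And>i. (0::complex^'n) $ i \<noteq> 0 \<Longrightarrow> u $ i = (0::complex^'n) $ i" and
      l: "(\<exists>k\<in>{1..k0}. l k \<noteq> 0) \<or> m \<noteq> 0" and m: "(\<forall>j::nat. (0::complex) = 0) \<Longrightarrow> m = 0" and
      lz: "\<And>k. k \<in> {1..k0} \<Longrightarrow> zeval (face_fun w (slice (F k) 0)) u \<noteq> 0 \<Longrightarrow> l k = 0" and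
      sum0: "\<And>i. (\<Sum>k\<in>{1..k0}. l k * (u $ i * cgrad (zeval (face_fun w (slice (F k) 0))) u $ i))
        = m * of_real ((cmod ((0::complex^'n) $ i))\<^sup>2)"
      by (rule log_gradient_limit[OF t H(3) H(4) z H(5) eq f0]) (assumption, rule that)
    define S where "S = {k\<in>{1..k0}. l k \<noteq> 0}"
    have S: "S \<noteq> {}" "S \<subseteq> {1..k0}" using l m by (auto simp: S_def)
    have \<tau>: "cmod 0 \<le> \<tau>0" using \<tau>0 by simp
    have wpos: "w i > 0" for i using w[of i] by (simp add: neq0_conv[symmetric] del: neq0_conv)
    have "cindep_on S UNIV (\<lambda>k. cgrad (zeval (face_fun w (slice (F k) 0))) u)"
      by (rule nondeg[OF S \<tau>, unfolded nondeg_ci_def, rule_format]) (use wpos u lz in \<open>auto simp: S_def\<close>)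
    moreover have "(\<Sum>k\<in>S. l k * cgrad (zeval (face_fun w (slice (F k) 0))) u $ i) = 0" for i
    proof -
      have "u $ i * (\<Sum>k\<in>S. l k * cgrad (zeval (face_fun w (slice (F k) 0))) u $ i)
         = (\<Sum>k\<in>S. l k * (u $ i * cgrad (zeval (face_fun w (slice (F k) 0))) u $ i))"
        by (simp add: sum_distrib_left mult_ac)
      also have "\<dots> = (\<Sum>k\<in>{1..k0}. l k * (u $ i * cgrad (zeval (face_fun w (slice (F k) 0))) u $ i))"
        by (rule sum.mono_neutral_left) (auto simp: S_def)
      also have "\<dots> = 0" unfolding sum0 by simp
      finally show ?thesis using u(1) by (simp add: torus_def)
    qed
    ultimately have "\<forall>k\<in>S. l k = 0" unfolding cindep_on_def by blast
    then show False using S(1) by (auto simp: S_def)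
  qed
next
  fix J :: "'n set" and \<rho> \<rho>' :: real
  assume A: "?P J \<rho>" and le: "\<rho>' \<le> \<rho>"
  show "?P J \<rho>'"
  proof (rule allI, rule allI, rule impI, rule impI)
    fix t and z :: "complex ^ 'n" assume "cmod t \<le> \<rho>'" "norm z \<le> \<rho>'"
    then have "cmod t \<le> \<rho>" "norm z \<le> \<rho>" using le by linarith+
    from A[THEN spec, THEN spec, THEN mp, OF this(1), THEN mp, OF this(2)]
    show "cmod t \<le> \<tau>0 \<longrightarrow>
     (\<forall>i. z $ i \<noteq> 0 \<longleftrightarrow> i \<in> J) \<longrightarrow> (\<forall>k\<in>{1..k0}. f k t z \<noteq> 0) \<longrightarrow>
     (\<exists>i. (\<Sum>k\<in>{1..k0}. z $ i * cgrad (f k t) z $ i / f k t z) \<noteq> 0)" .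
  qed
qed simp

text \<open>On the open torus of the coordinate subspace through \<open>z\<close>, this says that
  the gradients of the chosen vanishing factors are independent and that the sphere is transverse to
  their common zero set. The factor \<open>z $ i\<close> makes the equations for vanishing
  coordinates trivial, so only tangential derivatives count.\<close>

definition strata_transverse :: "real \<Rightarrow> bool" where
  "strata_transverse \<rho> \<longleftrightarrow> (\<forall>S t z a m. S \<subseteq> {1..k0} \<longrightarrow> cmod t \<le> \<rho> \<longrightarrow> norm z \<le> \<rho> \<longrightarrow> cmod t \<le> \<tau>0 \<longrightarrow> z \<noteq> 0 \<longrightarrow>
     (\<forall>k\<in>S. live {i. z $ i \<noteq> 0} k \<and> f k t z = 0) \<longrightarrow>
     (\<forall>i. (\<Sum>k\<in>S. a k * (z $ i * cgrad (f k t) z $ i)) = m * of_real ((cmod (z $ i))\<^sup>2)) \<longrightarrow>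
     (\<forall>k\<in>S. a k = 0) \<and> m = 0)"

lemma strata_transverseD:
  assumes "strata_transverse \<rho>" "S \<subseteq> {1..k0}" "cmod t \<le> \<rho>" "norm z \<le> \<rho>" "cmod t \<le> \<tau>0" "z \<noteq> 0"
    "\<And>k. k \<in> S \<Longrightarrow> live {i. z $ i \<noteq> 0} k \<and> f k t z = 0"
    "\<And>i. (\<Sum>k\<in>S. a k * (z $ i * cgrad (f k t) z $ i)) = m * of_real ((cmod (z $ i))\<^sup>2)"
  shows "(\<forall>k\<in>S. a k = 0) \<and> m = 0"
  using assms(1)[unfolded strata_transverse_def, THEN spec, THEN spec, THEN spec, THEN spec, THEN spec,
      THEN mp, OF assms(2), THEN mp, OF assms(3), THEN mp, OF assms(4), THEN mp, OF assms(5), THEN mp, OF assms(6),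
      of a m] assms(7,8) by blast

lemma strata_transverse_near_origin: "\<exists>\<rho>>0. strata_transverse \<rho>"
proof -
  obtain \<rho> where \<rho>: "\<rho> > 0" and A: "\<forall>(J, S)\<in>UNIV \<times> Pow {1..k0}. \<forall>t z a m. cmod t \<le> \<rho> \<longrightarrow> norm z \<le> \<rho> \<longrightarrow> cmod t \<le> \<tau>0 \<longrightarrow> J \<noteq> {} \<longrightarrow>
     (\<forall>i. z $ i \<noteq> 0 \<longleftrightarrow> i \<in> J) \<longrightarrow> (\<forall>k\<in>S. live J k \<and> f k t z = 0) \<longrightarrow>
     (\<forall>i. (\<Sum>k\<in>S. a k * (z $ i * cgrad (f k t) z $ i)) = m * of_real ((cmod (z $ i))\<^sup>2)) \<longrightarrow>
     (\<forall>k\<in>S. a k = 0) \<and> m = 0"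
    using stratum_transverse by blast
  have "strata_transverse \<rho>"
    unfolding strata_transverse_def
  proof (intro allI impI)
    fix S t and z :: "complex ^ 'n" and a m
    assume H: "S \<subseteq> {1..k0}" "cmod t \<le> \<rho>" "norm z \<le> \<rho>" "cmod t \<le> \<tau>0" "z \<noteq> 0"
     "\<forall>k\<in>S. live {i. z $ i \<noteq> 0} k \<and> f k t z = 0"
     "\<forall>i. (\<Sum>k\<in>S. a k * (z $ i * cgrad (f k t) z $ i)) = m * of_real ((cmod (z $ i))\<^sup>2)"
    have S: "({i. z $ i \<noteq> 0}, S) \<in> UNIV \<times> Pow {1..k0}" using H(1) by simp
    have ne: "{i. z $ i \<noteq> 0} \<noteq> {}" using H(5) by (auto simp: vec_eq_iff)
    have J: "\<forall>i. z $ i \<noteq> 0 \<longleftrightarrow> i \<in> {i. z $ i \<noteq> 0}" by simp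
    show "(\<forall>k\<in>S. a k = 0) \<and> m = 0"
      by (rule bspec[OF A S, unfolded prod.case, THEN spec, THEN spec, THEN spec, THEN spec, THEN mp, OF H(2),
            THEN mp, OF H(3), THEN mp, OF H(4), THEN mp, OF ne, THEN mp, OF J, THEN mp, OF H(6), THEN mp, OF H(7)])
  qed
  then show ?thesis using \<rho> by blast
qed

section \<open>Absence of tangencies near the zero fibre, away from the origin\<close>

text \<open>The factors whose face function vanishes at \<open>u\<close> are split by whether they
  vanish identically on the coordinate subspace of \<open>z0\<close>. In coordinates outside
  \<open>I\<close> the live factors and the radial term drop out, so tameness removes the dead
  factors. What remains is a relation at \<open>z0\<close> itself, excluded by
  \<open>strata_transverse\<close>.\<close>

lemma no_tangency_limit:
  assumes stratum: "strata_transverse \<rho>"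
    and t: "t \<longlonglongrightarrow> t0" "\<And>j. cmod (t j) \<le> \<tau>0" "cmod t0 \<le> \<rho>"
    and z: "z \<longlonglongrightarrow> z0" "z0 \<noteq> 0" "norm z0 \<le> \<rho>" "(norm z0)\<^sup>2 \<le> R"
    and J: "\<And>j i. z j $ i \<noteq> 0 \<longleftrightarrow> i \<in> J"
    and fn: "\<And>k j. k \<in> {1..k0} \<Longrightarrow> f k (t j) (z j) \<noteq> 0"
    and eq: "\<And>j i. (\<Sum>k\<in>{1..k0}. z j $ i * cgrad (f k (t j)) (z j) $ i / f k (t j) (z j))
         = \<mu> j * of_real ((cmod (z j $ i))\<^sup>2)"
    and f0: "(\<lambda>j. \<Prod>k\<in>{1..k0}. f k (t j) (z j)) \<longlonglongrightarrow> 0"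
  shows False
proof -
  have t0: "cmod t0 \<le> \<tau>0"
    by (rule LIMSEQ_le_const2[OF tendsto_norm[OF t(1)]]) (use t in auto)
  obtain w u l m where w: "\<And>i. w i = 0 \<longleftrightarrow> z0 $ i \<noteq> 0" and u: "u \<in> torus" 
    "\<And>i. z0 $ i \<noteq> 0 \<Longrightarrow> u $ i = z0 $ i" and
    lm: "(\<exists>k\<in>{1..k0}. l k \<noteq> 0) \<or> m \<noteq> 0" and "(\<forall>j. \<mu> j = 0) \<Longrightarrow> m = 0" and
    lz: "\<And>k. k \<in> {1..k0} \<Longrightarrow> zeval (face_fun w (slice (F k) t0)) u \<noteq> 0 \<Longrightarrow> l k = 0" and
    sum0: "\<And>i. (\<Sum>k\<in>{1..k0}. l k * (u $ i * cgrad (zeval (face_fun w (slice (F k) t0))) u $ i))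
        = m * of_real ((cmod (z0 $ i))\<^sup>2)"
    by (rule log_gradient_limit[OF t(1,2) J z(1) fn eq f0]) (assumption, rule that)
  define g where "g k = zeval (face_fun w (slice (F k) t0))" for k
  define I where "I = {i. z0 $ i \<noteq> 0}"
  have wI: "{i. w i = 0} = I" using w by (auto simp: I_def)
  have wu: "w i = 0 \<Longrightarrow> u $ i = z0 $ i" "w i > 0 \<Longrightarrow> z0 $ i = 0" for i
    using w[of i] u(2)[of i] by auto
  define S where "S = {k\<in>{1..k0}. g k u = 0}"
  define S1 where "S1 = {k\<in>S. \<not> live I k}"
  define S2 where "S2 = {k\<in>S. live I k}"
  have fS: "finite S1" "finite S2" "S = S1 \<union> S2" "S1 \<inter> S2 = {}" by (auto simp: S_def S1_def S2_def)
  have sumS: "(\<Sum>k\<in>S1. l k * (u $ i * cgrad (g k) u $ i)) + (\<Sum>k\<in>S2. l k * (u $ i * cgrad (g k) u $ i))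
      = m * of_real ((cmod (z0 $ i))\<^sup>2)" for i
  proof -
    have "(\<Sum>k\<in>S. l k * (u $ i * cgrad (g k) u $ i)) = (\<Sum>k\<in>{1..k0}. l k * (u $ i * cgrad (g k) u $ i))"
      by (rule sum.mono_neutral_left) (use lz in \<open>auto simp: S_def g_def\<close>)
    then show ?thesis using sum0[of i] fS by (simp add: g_def sum.union_disjoint)
  qed
  have S2: "g k u = f k t0 z0" "u $ i * cgrad (g k) u $ i = z0 $ i * cgrad (f k t0) z0 $ i" 
    if k: "k \<in> S2" for k i
  proof -
    have k': "k \<in> {1..k0}" and lv: "live I k" using k by (auto simp: S2_def S_def)
    obtain \<alpha>0 where a: "\<alpha>0 \<in> zsupp (slice (F k) t0)" "\<forall>i. i \<notin> I \<longrightarrow> \<alpha>0 i = 0"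
      using lv live_iff[OF k' t0] by blast
    have "wdeg w \<alpha>0 = 0" unfolding wdeg_eq_0_iff using a(2) wu(2) by (auto simp: I_def)
    then show "g k u = f k t0 z0" "u $ i * cgrad (g k) u $ i = z0 $ i * cgrad (f k t0) z0 $ i"
      unfolding g_def using face_fun_weight_zero[OF fin[OF k'] a(1) _ wu] by blast+
  qed
  have l1: "\<forall>k\<in>S1. l k = 0"
  proof (cases "S1 = {}")
    case False
    have S1: "S1 \<subseteq> {1..k0}" by (auto simp: S1_def S_def)
    obtain R' where R': "R' > R" "tame_radius S1 (\<lambda>k. slice (F k) t0) R'" using tame[OF False S1 t0] by blast
    have Ine: "I \<noteq> {}" using z(2) by (auto simp: I_def vec_eq_iff)
    have van: "\<forall>k\<in>S1. vanishes_on_coord (zeval (slice (F k) t0)) I"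
      using not_live_vanishes[OF _ t0] by (auto simp: S1_def S_def)
    \<comment> \<open>A zero weight would make \<open>I\<close> the full index set, and no factor is
      dead there because its support is nonempty.\<close>
    have wne: "w \<noteq> (\<lambda>_. 0)"
    proof
      assume "w = (\<lambda>_. 0)"
      then have "I = UNIV" using wI by auto
      moreover obtain k where k: "k \<in> S1" using False by blast
      ultimately have "\<not> live UNIV k" by (simp add: S1_def)
      then show False using zsupp_ne[of k 0] k S1 \<tau>0 by (auto simp: live_def)
    qed
    \<comment> \<open>On \<open>I\<close> the points \<open>u\<close> and \<open>z0\<close> agree,
      so the bound by \<open>R\<close> on the squared norm of \<open>z0\<close> becomes the strict
      bound by the larger \<open>R'\<close>.\<close>
    have "(\<Sum>i\<in>I. (cmod (u $ i))\<^sup>2) = (\<Sum>i\<in>I. (cmod (z0 $ i))\<^sup>2)"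
      using u(2) by (intro sum.cong) (auto simp: I_def)
    also have "\<dots> \<le> (\<Sum>i\<in>UNIV. (cmod (z0 $ i))\<^sup>2)" by (rule sum_mono2) auto
    also have "\<dots> = (norm z0)\<^sup>2" by (simp add: norm_vec_def L2_set_def sum_nonneg)
    finally have uR: "(\<Sum>i\<in>I. (cmod (u $ i))\<^sup>2) < R'" using z(4) R'(1) by linarith
    have gS: "\<forall>k\<in>S1. zeval (face_fun w (slice (F k) t0)) u = 0" by (auto simp: S1_def S_def g_def)
    have "cindep_on S1 (- I) (\<lambda>k. cgrad (g k) u)"
      unfolding g_def
      by (rule R'(2)[unfolded tame_radius_def, THEN conjunct2, THEN spec, THEN mp, OF conjI[OF Ine van],
            THEN spec, THEN mp, OF conjI[OF wne wI], THEN bspec, OF u(1), THEN mp, OF conjI[OF uR gS]])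
    moreover have "(\<Sum>k\<in>S1. l k * cgrad (g k) u $ i) = 0" if i: "i \<in> - I" for i
    proof -
      have z0i: "z0 $ i = 0" using i by (simp add: I_def)
      have "u $ i * (\<Sum>k\<in>S1. l k * cgrad (g k) u $ i) = (\<Sum>k\<in>S1. l k * (u $ i * cgrad (g k) u $ i))"
        by (simp add: sum_distrib_left mult_ac)
      also have "\<dots> = 0" using sumS[of i] by (simp add: S2(2) z0i)
      finally show ?thesis using u(1) by (simp add: torus_def)
    qed
    ultimately show ?thesis unfolding cindep_on_def by blast
  qed simp
  have S2m: "(\<forall>k\<in>S2. l k = 0) \<and> m = 0"
  proof (rule strata_transverseD[OF stratum _ t(3) z(3) t0 z(2)])
    show "S2 \<subseteq> {1..k0}" by (auto simp: S2_def S_def)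
    show "live {i. z0 $ i \<noteq> 0} k \<and> f k t0 z0 = 0" if "k \<in> S2" for k
      using that S2(1)[OF that] by (auto simp: S2_def S_def I_def)
    show "(\<Sum>k\<in>S2. l k * (z0 $ i * cgrad (f k t0) z0 $ i)) = m * of_real ((cmod (z0 $ i))\<^sup>2)" for i
      using sumS[of i] l1 by (simp add: S2(2))
  qed
  have "l k = 0" if "k \<in> {1..k0}" for k
  proof (cases "k \<in> S")
    case True
    then show ?thesis using l1 S2m fS(3) by blast
  next
    case False
    then show ?thesis using lz[OF that] that by (simp add: S_def g_def)
  qed
  then show False using lm S2m by blast
qed

text \<open>The shell is compact and avoids the origin, so tangencies at ever smaller values of the
  product accumulate at a nonzero point to which \<open>no_tangency_limit\<close> applies.\<close>

lemma no_tangency_near_zero_fibre: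
  assumes stratum: "strata_transverse \<rho>"
    and \<epsilon>: "0 < \<epsilon>'" "\<epsilon> \<le> \<rho>" "\<epsilon>\<^sup>2 \<le> R"
  shows "\<exists>\<delta>>0. \<forall>J\<in>UNIV. \<forall>t z \<mu>. cmod (\<Prod>k\<in>{1..k0}. f k t z) \<le> \<delta> \<longrightarrow> cmod t \<le> \<rho> \<longrightarrow> cmod t \<le> \<tau>0 \<longrightarrow> 
      \<epsilon>' \<le> norm z \<longrightarrow> norm z \<le> \<epsilon> \<longrightarrow> (\<forall>i. z $ i \<noteq> 0 \<longleftrightarrow> i \<in> J) \<longrightarrow> (\<forall>k\<in>{1..k0}. f k t z \<noteq> 0) \<longrightarrow> 
      (\<exists>i. (\<Sum>k\<in>{1..k0}. z $ i * cgrad (f k t) z $ i / f k t z) \<noteq> \<mu> * of_real ((cmod (z $ i))\<^sup>2))"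
    (is "\<exists>\<delta>>0. \<forall>J\<in>UNIV. ?P J \<delta>")
proof (rule finite_uniform_radius)
  fix J :: "'n set"
  show "\<exists>\<delta>>0. ?P J \<delta>"
  proof (rule ccontr)
    assume neg: "\<not> ?thesis"
    have nP: "\<not> ?P J (1 / real (Suc n))" for n
    proof (rule notI, rule notE[OF neg], rule exI, rule conjI)
      show "1 / real (Suc n) > 0" by simp
    qed
    define Q where "Q n t z \<mu> \<longleftrightarrow> cmod (\<Prod>k\<in>{1..k0}. f k t z) \<le> 1 / real (Suc n) \<and> cmod t \<le> \<rho> \<and> cmod t \<le> \<tau>0 \<and> 
      \<epsilon>' \<le> norm z \<and> norm z \<le> \<epsilon> \<and> (\<forall>i. z $ i \<noteq> 0 \<longleftrightarrow> i \<in> J) \<and> (\<forall>k\<in>{1..k0}. f k t z \<noteq> 0) \<and>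
      (\<forall>i. (\<Sum>k\<in>{1..k0}. z $ i * cgrad (f k t) z $ i / f k t z) = \<mu> * of_real ((cmod (z $ i))\<^sup>2))" for n :: nat and t z \<mu>
    have "\<exists>t z \<mu>. Q n t z \<mu>" for n
      using nP[of n] unfolding Q_def by (auto simp del: of_nat_Suc)
    then obtain t z \<mu> where "\<And>n. Q n (t n) (z n) (\<mu> n)" by metis
    then have H: "\<And>n. cmod (\<Prod>k\<in>{1..k0}. f k (t n) (z n)) \<le> 1 / real (Suc n)" 
      "\<And>n. cmod (t n) \<le> \<rho>" "\<And>n. cmod (t n) \<le> \<tau>0"
      "\<And>n. \<epsilon>' \<le> norm (z n)" "\<And>n. norm (z n) \<le> \<epsilon>" "\<And>n i. z n $ i \<noteq> 0 \<longleftrightarrow> i \<in> J"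
      "\<And>n k. k \<in> {1..k0} \<Longrightarrow> f k (t n) (z n) \<noteq> 0"
      "\<And>n i. (\<Sum>k\<in>{1..k0}. z n $ i * cgrad (f k (t n)) (z n) $ i / f k (t n) (z n)) = \<mu> n * of_real ((cmod (z n $ i))\<^sup>2)"
      unfolding Q_def by blast+
    have "bounded (range t)" using H(2) by (auto simp: bounded_iff)
    then obtain r1 t0 where r1: "strict_mono (r1 :: nat \<Rightarrow> nat)" "(\<lambda>n. t (r1 n)) \<longlonglongrightarrow> t0"
      using bounded_imp_convergent_subsequence[of t] by (auto simp: o_def)
    have "bounded (range (\<lambda>n. z (r1 n)))" using H(5) by (auto simp: bounded_iff)
    then obtain r2 z0 where r2: "strict_mono (r2 :: nat \<Rightarrow> nat)" "(\<lambda>n. z (r1 (r2 n))) \<longlonglongrightarrow> z0"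
      using bounded_imp_convergent_subsequence[of "\<lambda>n. z (r1 n)"] by (auto simp: o_def)
    have t: "(\<lambda>n. t (r1 (r2 n))) \<longlonglongrightarrow> t0"
      using LIMSEQ_subseq_LIMSEQ[OF r1(2) r2(1)] by (simp add: o_def)
    have t0: "cmod t0 \<le> \<rho>" by (rule LIMSEQ_le_const2[OF tendsto_norm[OF t]]) (use H in auto)
    have z0: "norm z0 \<le> \<epsilon>" by (rule LIMSEQ_le_const2[OF tendsto_norm[OF r2(2)]]) (use H in auto)
    have "\<epsilon>' \<le> norm z0" by (rule LIMSEQ_le_const[OF tendsto_norm[OF r2(2)]]) (use H in auto)
    then have z0': "z0 \<noteq> 0" using \<epsilon>(1) by auto
    have "norm z0 \<le> \<rho>" "(norm z0)\<^sup>2 \<le> R"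
      using z0 \<epsilon>(2,3) power_mono[OF z0 norm_ge_zero, of 2] by linarith+
    moreover have "(\<lambda>n. \<Prod>k\<in>{1..k0}. f k (t (r1 (r2 n))) (z (r1 (r2 n)))) \<longlonglongrightarrow> 0"
      using LIMSEQ_subseq_LIMSEQ[OF LIMSEQ_subseq_LIMSEQ[OF small_sequence[OF H(1)] r1(1)] r2(1)]
      unfolding o_def .
    ultimately show False
      by (intro no_tangency_limit[OF stratum t H(3) t0 r2(2) z0' _ _ H(6) H(7) H(8)])
  qed
next
  fix J :: "'n set" and \<rho>' \<rho>'' :: real
  assume A: "?P J \<rho>'" and le: "\<rho>'' \<le> \<rho>'"
  show "?P J \<rho>''"
  proof (rule allI, rule allI, rule allI, rule impI)
    fix t and z :: "complex ^ 'n" and \<mu> assume "cmod (\<Prod>k\<in>{1..k0}. f k t z) \<le> \<rho>''"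
    then have "cmod (\<Prod>k\<in>{1..k0}. f k t z) \<le> \<rho>'" using le by linarith
    from A[THEN spec, THEN spec, THEN spec, THEN mp, OF this]
    show "cmod t \<le> \<rho> \<longrightarrow> cmod t \<le> \<tau>0 \<longrightarrow> 
      \<epsilon>' \<le> norm z \<longrightarrow> norm z \<le> \<epsilon> \<longrightarrow> (\<forall>i. z $ i \<noteq> 0 \<longleftrightarrow> i \<in> J) \<longrightarrow> (\<forall>k\<in>{1..k0}. f k t z \<noteq> 0) \<longrightarrow> 
      (\<exists>i. (\<Sum>k\<in>{1..k0}. z $ i * cgrad (f k t) z $ i / f k t z) \<noteq> \<mu> * of_real ((cmod (z $ i))\<^sup>2))" .
  qed
qed simp

section \<open>The stable radius\<close>

lemma cgrad_prod:
  assumes "\<And>k. k \<in> {1..k0} \<Longrightarrow> f k t z \<noteq> 0"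
  shows "cgrad (\<lambda>z. (\<Prod>k\<in>{1..k0}. tzeval (F k) t z) - \<eta>) z $ i
     = (\<Prod>k\<in>{1..k0}. f k t z) * (\<Sum>k\<in>{1..k0}. cgrad (f k t) z $ i / f k t z)"
proof -
  have upd: "(\<chi> j. if j = i then z $ i else z $ j) = z" by (simp add: vec_eq_iff)
  have "((\<lambda>x. \<Prod>k\<in>{1..k0}. f k t (\<chi> j. if j = i then x else z $ j)) has_field_derivative
     (\<Prod>k\<in>{1..k0}. f k t (\<chi> j. if j = i then z $ i else z $ j)) * 
     (\<Sum>k\<in>{1..k0}. cgrad (f k t) z $ i / f k t (\<chi> j. if j = i then z $ i else z $ j))) (at (z $ i))"
    by (rule has_field_derivative_prod') (use assms in \<open>auto simp: upd intro!: zeval_has_partial(1) fin\<close>)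
  then have "((\<lambda>x. (\<Prod>k\<in>{1..k0}. f k t (\<chi> j. if j = i then x else z $ j)) - \<eta>) has_field_derivative
     (\<Prod>k\<in>{1..k0}. f k t z) * (\<Sum>k\<in>{1..k0}. cgrad (f k t) z $ i / f k t z)) (at (z $ i))"
    unfolding upd by (auto intro!: derivative_eq_intros)
  moreover have "(\<Prod>k\<in>{1..k0}. tzeval (F k) t x) = (\<Prod>k\<in>{1..k0}. f k t x)" for x
    by (intro prod.cong refl tzeval_eq_zeval_slice poly)
  ultimately show ?thesis by (simp only: cgrad_def cpartial_def vec_lambda_beta DERIV_imp_deriv)
qed

lemma uniform_stable_radius:
  assumes "k0 \<ge> 1"
  shows "\<exists>\<tau>>0. \<exists>r>0. \<forall>\<epsilon> \<epsilon>'. 0 < \<epsilon>' \<and> \<epsilon>' \<le> \<epsilon> \<and> \<epsilon> \<le> r \<longrightarrow>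
           (\<exists>\<delta>>0. \<forall>\<eta>::complex. 0 < cmod \<eta> \<and> cmod \<eta> \<le> \<delta> \<longrightarrow>
              (\<forall>t. cmod t \<le> \<tau> \<longrightarrow>
                 (let h = (\<lambda>z. (\<Prod>k\<in>{1..k0}. tzeval (F k) t z) - \<eta>) in
                   nonsingular_in h (ball 0 r) \<and>
                   (\<forall>\<epsilon>''\<in>{\<epsilon>'..\<epsilon>}. transverse_sphere h \<epsilon>''))))"
proof -
  obtain \<rho>1 where \<rho>1: "\<rho>1 > 0" and stratum: "strata_transverse \<rho>1"
    using strata_transverse_near_origin by blast
  obtain \<rho>2 where \<rho>2: "\<rho>2 > 0" and C: "\<forall>J\<in>UNIV. \<forall>t z. cmod t \<le> \<rho>2 \<longrightarrow> norm z \<le> \<rho>2 \<longrightarrow> cmod t \<le> \<tau>0 \<longrightarrow>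
     (\<forall>i. z $ i \<noteq> 0 \<longleftrightarrow> i \<in> J) \<longrightarrow> (\<forall>k\<in>{1..k0}. f k t z \<noteq> 0) \<longrightarrow>
     (\<exists>i. (\<Sum>k\<in>{1..k0}. z $ i * cgrad (f k t) z $ i / f k t z) \<noteq> 0)"
    using smooth_near_origin[OF assms(1)] by blast
  have smooth: "\<exists>i. (\<Sum>k\<in>{1..k0}. z $ i * cgrad (f k t) z $ i / f k t z) \<noteq> 0"
    if "cmod t \<le> \<rho>2" "norm z \<le> \<rho>2" "cmod t \<le> \<tau>0" "\<And>k. k \<in> {1..k0} \<Longrightarrow> f k t z \<noteq> 0" for t z
    using C[THEN bspec, OF UNIV_I, of "{i. z $ i \<noteq> 0}", THEN spec, THEN spec, THEN mp, OF that(1), THEN mp, OF that(2), THEN mp, OF that(3)] that(4)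
    by blast
  define \<tau> where "\<tau> = min \<tau>0 (min \<rho>1 \<rho>2)"
  \<comment> \<open>The bounds 1 and \<open>R\<close> together give
    \<open>\<epsilon>\<^sup>2 \<le> \<epsilon> \<le> R\<close>, the form in which tameness is
    used.\<close>
  define r where "r = min (min \<rho>1 \<rho>2) (min 1 R)"
  have \<tau>: "\<tau> > 0" "\<tau> \<le> \<tau>0" "\<tau> \<le> \<rho>1" "\<tau> \<le> \<rho>2" using \<rho>1 \<rho>2 \<tau>0 by (auto simp: \<tau>_def)
  have r: "r > 0" "r \<le> \<rho>1" "r \<le> \<rho>2" "r \<le> 1" "r \<le> R" using \<rho>1 \<rho>2 R by (auto simp: r_def)
  have fibre: "(\<Prod>k\<in>{1..k0}. f k t z) = \<eta>" "k \<in> {1..k0} \<Longrightarrow> f k t z \<noteq> 0"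
    if "(\<Prod>k\<in>{1..k0}. tzeval (F k) t z) - \<eta> = 0" "cmod \<eta> > 0" for t z \<eta> k
  proof -
    have "(\<Prod>k\<in>{1..k0}. tzeval (F k) t z) = (\<Prod>k\<in>{1..k0}. f k t z)"
      by (intro prod.cong refl tzeval_eq_zeval_slice poly)
    then show e: "(\<Prod>k\<in>{1..k0}. f k t z) = \<eta>" using that(1) by simp
    then show "f k t z \<noteq> 0" if "k \<in> {1..k0}"
      using that \<open>cmod \<eta> > 0\<close> prod_zero_iff[of "{1..k0}" "\<lambda>k. f k t z"] by auto
  qed
  \<comment> \<open>The closed ball is covered because the sphere of radius \<open>r\<close> itself
    may occur in the transversality claim.\<close>
  have nonsing: "cgrad (\<lambda>z. (\<Prod>k\<in>{1..k0}. tzeval (F k) t z) - \<eta>) z \<noteq> 0"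
    if h: "(\<Prod>k\<in>{1..k0}. tzeval (F k) t z) - \<eta> = 0" "cmod \<eta> > 0" and "cmod t \<le> \<tau>" "norm z \<le> r" for t z \<eta>
  proof
    assume g0: "cgrad (\<lambda>z. (\<Prod>k\<in>{1..k0}. tzeval (F k) t z) - \<eta>) z = 0"
    have "(\<Sum>k\<in>{1..k0}. cgrad (f k t) z $ i / f k t z) = 0" for i
      using cgrad_prod[OF fibre(2)[OF h], of \<eta> i] g0 h(2) fibre(1)[OF h] by simp
    then have "(\<Sum>k\<in>{1..k0}. z $ i * cgrad (f k t) z $ i / f k t z) = 0" for i
      by (metis (no_types, lifting) mult_zero_right sum.cong sum_distrib_left times_divide_eq_right)
    moreover have "cmod t \<le> \<rho>2" "norm z \<le> \<rho>2" "cmod t \<le> \<tau>0" using that \<tau> r by linarith+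
    ultimately show False using smooth[OF _ _ _ fibre(2)[OF h]] by blast
  qed
  show ?thesis
  proof (rule exI[of _ \<tau>], rule conjI[OF \<tau>(1)], rule exI[of _ r], rule conjI[OF r(1)], intro allI impI)
    fix \<epsilon> \<epsilon>' :: real assume e: "0 < \<epsilon>' \<and> \<epsilon>' \<le> \<epsilon> \<and> \<epsilon> \<le> r"
    have "\<epsilon>\<^sup>2 \<le> \<epsilon> * 1" unfolding power2_eq_square using e r by (intro mult_left_mono) auto
    then have eR: "0 < \<epsilon>'" "\<epsilon> \<le> \<rho>1" "\<epsilon>\<^sup>2 \<le> R" using e r by linarith+
    obtain \<delta> where \<delta>: "\<delta> > 0" and D: "\<forall>J\<in>UNIV. \<forall>t z \<mu>. cmod (\<Prod>k\<in>{1..k0}. f k t z) \<le> \<delta> \<longrightarrow> cmod t \<le> \<rho>1 \<longrightarrow> cmod t \<le> \<tau>0 \<longrightarrow> 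
      \<epsilon>' \<le> norm z \<longrightarrow> norm z \<le> \<epsilon> \<longrightarrow> (\<forall>i. z $ i \<noteq> 0 \<longleftrightarrow> i \<in> J) \<longrightarrow> (\<forall>k\<in>{1..k0}. f k t z \<noteq> 0) \<longrightarrow> 
      (\<exists>i. (\<Sum>k\<in>{1..k0}. z $ i * cgrad (f k t) z $ i / f k t z) \<noteq> \<mu> * of_real ((cmod (z $ i))\<^sup>2))"
      using no_tangency_near_zero_fibre[OF stratum eR] by blast
    show "\<exists>\<delta>>0. \<forall>\<eta>::complex. 0 < cmod \<eta> \<and> cmod \<eta> \<le> \<delta> \<longrightarrow>
              (\<forall>t. cmod t \<le> \<tau> \<longrightarrow>
                 (let h = (\<lambda>z. (\<Prod>k\<in>{1..k0}. tzeval (F k) t z) - \<eta>) in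
                   nonsingular_in h (ball 0 r) \<and>
                   (\<forall>\<epsilon>''\<in>{\<epsilon>'..\<epsilon>}. transverse_sphere h \<epsilon>'')))"
      unfolding Let_def
    proof (intro exI[of _ \<delta>] conjI \<delta> allI impI ballI)
      fix \<eta> t assume \<eta>: "0 < cmod \<eta> \<and> cmod \<eta> \<le> \<delta>" and t: "cmod t \<le> \<tau>"
      let ?h = "\<lambda>z. (\<Prod>k\<in>{1..k0}. tzeval (F k) t z) - \<eta>"
      show "nonsingular_in ?h (ball 0 r)"
        unfolding nonsingular_in_def
      proof (intro ballI impI)
        fix z :: "complex ^ 'n" assume "z \<in> ball 0 r" "?h z = 0"
        then show "cgrad ?h z \<noteq> 0" using nonsing[of t z \<eta>] \<eta> t by simp
      qed
      fix \<epsilon>'' assume e'': "\<epsilon>'' \<in> {\<epsilon>'..\<epsilon>}"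
      show "transverse_sphere ?h \<epsilon>''"
        unfolding transverse_sphere_def
      proof (intro ballI impI)
        fix z :: "complex ^ 'n" assume z: "z \<in> sphere 0 \<epsilon>''" and h: "?h z = 0"
        have nz: "\<epsilon>' \<le> norm z" "norm z \<le> \<epsilon>" "norm z \<le> r" using z e'' e by auto
        then have z0: "z \<noteq> 0" using e by auto
        have \<eta>0: "cmod \<eta> > 0" using \<eta> by blast
        have g: "cgrad ?h z \<noteq> 0" by (rule nonsing[OF h \<eta>0 t nz(3)])
        \<comment> \<open>If the gradient were a multiple of the conjugate of \<open>z\<close>,
          dividing by eta and multiplying by \<open>z $ i\<close> would give the relation excluded
          by \<open>D\<close>, with parameter \<open>\<mu> / \<eta>\<close>.\<close>
        have npar: "\<not> (\<exists>\<mu>. \<forall>i. cgrad ?h z $ i = \<mu> * cnj (z $ i))"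
        proof
          assume "\<exists>\<mu>. \<forall>i. cgrad ?h z $ i = \<mu> * cnj (z $ i)"
          then obtain \<mu> where \<mu>: "\<And>i. cgrad ?h z $ i = \<mu> * cnj (z $ i)" by blast
          have "(\<Sum>k\<in>{1..k0}. z $ i * cgrad (f k t) z $ i / f k t z) = (\<mu> / \<eta>) * of_real ((cmod (z $ i))\<^sup>2)" for i
          proof -
            have "\<mu> * cnj (z $ i) = \<eta> * (\<Sum>k\<in>{1..k0}. cgrad (f k t) z $ i / f k t z)"
              using cgrad_prod[OF fibre(2)[OF h \<eta>0], of \<eta> i] \<mu>[of i] fibre(1)[OF h \<eta>0] by simp
            then have "(\<Sum>k\<in>{1..k0}. cgrad (f k t) z $ i / f k t z) = (\<mu> / \<eta>) * cnj (z $ i)"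
              using \<eta>0 by (simp add: field_simps)
            then have "z $ i * (\<Sum>k\<in>{1..k0}. cgrad (f k t) z $ i / f k t z) = (\<mu> / \<eta>) * (z $ i * cnj (z $ i))"
              by simp
            then show ?thesis unfolding complex_norm_square by (simp add: sum_distrib_left)
          qed
          moreover have "cmod (\<Prod>k\<in>{1..k0}. f k t z) \<le> \<delta>" "cmod t \<le> \<rho>1" "cmod t \<le> \<tau>0"
            using fibre(1)[OF h \<eta>0] \<eta> t \<tau> by auto
          note D[THEN bspec, OF UNIV_I, of "{i. z $ i \<noteq> 0}", THEN spec, THEN spec, THEN spec, THEN mp, OF this(1), 
             THEN mp, OF this(2), THEN mp, OF this(3), THEN mp, OF nz(1), THEN mp, OF nz(2)]
          ultimately show False using fibre(2)[OF h \<eta>0] by blast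
        qed
        show "cgrad ?h z \<noteq> 0 \<and> (\<forall>v. \<exists>a b. v = a + b \<and> (\<Sum>i\<in>UNIV. cgrad ?h z $ i * a $ i) = 0 \<and>
                   Re (\<Sum>i\<in>UNIV. b $ i * cnj (z $ i)) = 0)"
          using g hyperplane_transverse[OF g z0 npar] by blast
      qed
    qed
  qed
qed

end

theorem theorem5p1:
  fixes k0 :: nat and F :: "nat \<Rightarrow> ('n::finite) tzpoly"
  assumes "k0 \<ge> 1"
    and "\<forall>k\<in>{1..k0}. is_tzpoly (F k) \<and> nonconstant_tz (F k)"
    and "\<forall>k\<in>{1..k0}. \<forall>t. tzeval (F k) t 0 = 0"
    and "newton_admissible k0 F"
  shows "\<exists>\<tau>>0. \<exists>r>0. \<forall>\<epsilon> \<epsilon>'. 0 < \<epsilon>' \<and> \<epsilon>' \<le> \<epsilon> \<and> \<epsilon> \<le> r \<longrightarrow>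
           (\<exists>\<delta>>0. \<forall>\<eta>::complex. 0 < cmod \<eta> \<and> cmod \<eta> \<le> \<delta> \<longrightarrow>
              (\<forall>t. cmod t \<le> \<tau> \<longrightarrow>
                 (let h = (\<lambda>z. (\<Prod>k\<in>{1..k0}. tzeval (F k) t z) - \<eta>) in
                   nonsingular_in h (ball 0 r) \<and>
                   (\<forall>\<epsilon>''\<in>{\<epsilon>'..\<epsilon>}. transverse_sphere h \<epsilon>''))))"
proof -
  obtain R \<tau>0 where "R > 0" "\<tau>0 > 0" and adm: "\<forall>t. cmod t \<le> \<tau>0 \<longrightarrow>
        (\<forall>k\<in>{1..k0}. newton_boundary (slice (F k) t) = newton_boundary (slice (F k) 0)) \<and>
        (\<forall>S. S \<noteq> {} \<and> S \<subseteq> {1..k0} \<longrightarrow>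
           nondeg_ci S (\<lambda>k. slice (F k) t) \<and>
           (\<exists>R'>R. tame_radius S (\<lambda>k. slice (F k) t) R'))"
    using assms(4) unfolding newton_admissible_def by blast
  have "newton_family k0 F \<tau>0 R"
    by unfold_locales (use assms \<open>R > 0\<close> \<open>\<tau>0 > 0\<close> adm in blast)+
  then show ?thesis using assms(1) by (rule newton_family.uniform_stable_radius)
qed

end
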